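(* Let $n\ge 1$ and let $Q_n$ be the fractal Möbius octagonal network of $n$ octagons. Let $0=\alpha_1<\alpha_2\le\cdots\le\alpha_{3n}$ be the eigenvalues of the matrix $\mathcal{L}_A$ and $0<\rho_1\le\rho_2\le\cdots\le\rho_{3n}$ the eigenvalues of the matrix $\mathcal{L}_S$ (both associated with $Q_n$ as in the context). Then the multiplicative degree-Kirchhoff index of $Q_n$ satisfies $$DK(Q_n)=14n\left(\sum_{j=2}^{3n}\frac{1}{\alpha_j}+\sum_{j=1}^{3n}\frac{1}{\rho_j}\right)=14n\left(\frac{147n^{2}-19}{84}+\xi_n\right)=\frac{147n^{3}}{6}-\frac{19n}{6}+14n\,\xi_n,$$ where $$\xi_n=\frac{\frac{37\sqrt{15}\,n}{30}\left[\left(\frac{4+\sqrt{15}}{12}\right)^{n}-\left(\frac{4-\sqrt{15}}{12}\right)^{n}\right]}{\left(\frac{4+\sqrt{15}}{12}\right)^{n}+\left(\frac{4-\sqrt{15}}{12}\right)^{n}+2\left(\frac{1}{12}\right)^{n}}.$$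
   Context: The graph $Q_n$ (simple, undirected) has $6n$ vertices $1,2,\ldots,3n$ and $\overline{1},\overline{2},\ldots,\overline{3n}$, and $7n$ edges: $\{i,i+1\}$ and $\{\overline{i},\overline{i+1}\}$ for $1\le i\le 3n-1$; $\{3n,\overline{1}\}$ and $\{\overline{3n},1\}$; and the rungs $\{i,\overline{i}\}$ for $1\le i\le 3n$ with $i\equiv 1 \pmod 3$. (It is obtained from the linear chain $L_n$ of $n$ octagons by identifying the two opposite lateral edges in the reversed way.) Vertices $i,\overline{i}$ with $i\equiv1\pmod 3$ have degree 3; all others have degree 2. The normalized Laplacian $\mathcal{L}(G)$ of a graph $G$ has diagonal entries $1$, entry $-1/\sqrt{d_ud_v}$ for distinct adjacent vertices $u,v$ (where $d_u$ is the degree of $u$), and $0$ otherwise. With $V_1=\{1,\ldots,3n\}$ and $V_2=\{\overline{1},\ldots,\overline{3n}\}$ in this order, let $\mathcal{L}_{V_1V_1}$ and $\mathcal{L}_{V_1V_2}$ be the $3n\times 3n$ submatrices of $\mathcal{L}(Q_n)$ with rows indexed by $V_1$ and columns indexed by $V_1$, respectively $V_2$. Set $\mathcal{L}_A=\mathcal{L}_{V_1V_1}+\mathcal{L}_{V_1V_2}$ and $\mathcal{L}_S=\mathcal{L}_{V_1V_1}-\mathcal{L}_{V_1V_2}$. For a connected graph $G$, the multiplicative degree-Kirchhoff index is $DK(G)=\sum_{\{u,v\}}d_ud_vr_{uv}$, the sum over unordered pairs of distinct vertices, where $r_{uv}$ is the effective resistance between $u$ and $v$ when each edge is replaced by a unit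 resistor. *)

theory Defs
  imports Complex_Main "Jordan_Normal_Form.Char_Poly"
begin

section \<open>Simple undirected graphs\<close>

text \<open>A simple graph is given by its vertex set and its set of edges, each edge being a
  two-element set of vertices.\<close>

type_synonym 'v ugraph = "'v set \<times> 'v set set"

definition nbrs :: "'v ugraph \<Rightarrow> 'v \<Rightarrow> 'v set" where
  "nbrs G u = {v \<in> fst G. {u, v} \<in> snd G}"

definition vdeg :: "'v ugraph \<Rightarrow> 'v \<Rightarrow> nat" where
  "vdeg G u = card (nbrs G u)"

definition norm_laplacian :: "'v ugraph \<Rightarrow> 'v \<Rightarrow> 'v \<Rightarrow> real" where
  "norm_laplacian G u v =
     (if u = v then 1
      else if {u, v} \<in> snd G then - 1 / sqrt (real (vdeg G u) * real (vdeg G v))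
      else 0)"

text \<open>Every edge is a unit resistor, so by Ohm's law the current from x to y along an edge is
  the potential difference \<open>\<phi> x - \<phi> y\<close>. Kirchhoff's current law says that the net current
  out of each vertex is the external current fed in there: \<open>1\<close> at the source u, \<open>-1\<close> at the
  sink v, \<open>0\<close> elsewhere. The effective resistance is the resulting potential difference
  between u and v. On a finite connected graph it is uniquely determined, and only there is it
  meaningful.\<close>

definition unit_flow_potential :: "'v ugraph \<Rightarrow> 'v \<Rightarrow> 'v \<Rightarrow> ('v \<Rightarrow> real) \<Rightarrow> bool" where
  "unit_flow_potential G u v \<phi> \<longleftrightarrow>
     (\<forall>x\<in>fst G. (\<Sum>y\<in>nbrs G x. \<phi> x - \<phi> y) =
        (if x = u then 1 else 0) - (if x = v then 1 else 0))"

definition eff_resistance :: "'v ugraph \<Rightarrow> 'v \<Rightarrow> 'v \<Rightarrow> real" where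
  "eff_resistance G u v = (THE r. \<exists>\<phi>. unit_flow_potential G u v \<phi> \<and> r = \<phi> u - \<phi> v)"

lemma unit_flow_potential_uminus:
  assumes "unit_flow_potential G u v \<phi>"
  shows "unit_flow_potential G v u (\<lambda>x. - \<phi> x)"
  unfolding unit_flow_potential_def
proof
  fix x assume "x \<in> fst G"
  hence "(\<Sum>y\<in>nbrs G x. \<phi> x - \<phi> y) = (if x = u then 1 else 0) - (if x = v then 1 else 0)"
    using assms unfolding unit_flow_potential_def by blast
  moreover have "(\<Sum>y\<in>nbrs G x. - \<phi> x - - \<phi> y) = - (\<Sum>y\<in>nbrs G x. \<phi> x - \<phi> y)"
    by (simp add: sum_negf [symmetric])
  ultimately show "(\<Sum>y\<in>nbrs G x. - \<phi> x - - \<phi> y) =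
      (if x = v then 1 else 0) - (if x = u then 1 else 0)"
    by simp
qed

lemma eff_resistance_commute: "eff_resistance G u v = eff_resistance G v u"
proof -
  have *: "\<exists>\<psi>. unit_flow_potential G b a \<psi> \<and> r = \<psi> b - \<psi> a"
    if "\<exists>\<phi>. unit_flow_potential G a b \<phi> \<and> r = \<phi> a - \<phi> b" for a b r
  proof -
    from that obtain \<phi> where \<phi>: "unit_flow_potential G a b \<phi>" "r = \<phi> a - \<phi> b"
      by (elim exE conjE)
    have "r = - \<phi> b - - \<phi> a" using \<phi>(2) by simp
    with unit_flow_potential_uminus [OF \<phi>(1)] show ?thesis
      by (intro exI [of _ "\<lambda>x. - \<phi> x"] conjI)
  qed
  have "(\<lambda>r. \<exists>\<phi>. unit_flow_potential G u v \<phi> \<and> r = \<phi> u - \<phi> v) =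
        (\<lambda>r. \<exists>\<phi>. unit_flow_potential G v u \<phi> \<and> r = \<phi> v - \<phi> u)"
    by (intro ext iffI) (erule *)+
  thus ?thesis unfolding eff_resistance_def by (rule arg_cong)
qed

text \<open>The double sum runs over ordered pairs of distinct vertices, so it meets each unordered
  pair exactly twice, with the same summand because of
  \<open>eff_resistance_commute\<close>; hence the division by 2.\<close>

definition mult_degree_kirchhoff :: "'v ugraph \<Rightarrow> real" where
  "mult_degree_kirchhoff G =
     (\<Sum>u\<in>fst G. \<Sum>v\<in>fst G - {u}.
        real (vdeg G u) * real (vdeg G v) * eff_resistance G u v) / 2"

section \<open>Eigenvalues of a real matrix\<close>

text \<open>The real eigenvalues in increasing order, each repeated according to its algebraic
  multiplicity. For a matrix with only real eigenvalues this list has as many entries as the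
  matrix has rows.\<close>

definition eigenvalue_list :: "real mat \<Rightarrow> real list" where
  "eigenvalue_list A = sorted_list_of_multiset (proots (char_poly A))"

section \<open>The fractal Moebius octagonal network\<close>

text \<open>\<open>Plain i\<close> and \<open>Bar i\<close> are the vertices written $i$ and $\overline{i}$,
  with $1 \le i \le 3n$.\<close>

datatype vertex = Plain nat | Bar nat

definition Q_verts :: "nat \<Rightarrow> vertex set" where
  "Q_verts n = Plain ` {1..3 * n} \<union> Bar ` {1..3 * n}"

definition Q_edges :: "nat \<Rightarrow> vertex set set" where
  "Q_edges n =
     {{Plain i, Plain (i + 1)} |i. 1 \<le> i \<and> i \<le> 3 * n - 1} \<union>
     {{Bar i, Bar (i + 1)} |i. 1 \<le> i \<and> i \<le> 3 * n - 1} \<union>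
     {{Plain (3 * n), Bar 1}, {Bar (3 * n), Plain 1}} \<union>
     {{Plain i, Bar i} |i. 1 \<le> i \<and> i \<le> 3 * n \<and> i mod 3 = 1}"

definition Q :: "nat \<Rightarrow> vertex ugraph" where
  "Q n = (Q_verts n, Q_edges n)"

text \<open>Matrix indices start at 0, vertex labels at 1.\<close>

definition L_11 :: "nat \<Rightarrow> real mat" where
  "L_11 n = mat (3 * n) (3 * n)
     (\<lambda>(i, j). norm_laplacian (Q n) (Plain (i + 1)) (Plain (j + 1)))"

definition L_12 :: "nat \<Rightarrow> real mat" where
  "L_12 n = mat (3 * n) (3 * n)
     (\<lambda>(i, j). norm_laplacian (Q n) (Plain (i + 1)) (Bar (j + 1)))"

definition L_A :: "nat \<Rightarrow> real mat" where
  "L_A n = L_11 n + L_12 n"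

definition L_S :: "nat \<Rightarrow> real mat" where
  "L_S n = L_11 n - L_12 n"

definition xi :: "nat \<Rightarrow> real" where
  "xi n =
     (37 * sqrt 15 * real n / 30 * (((4 + sqrt 15) / 12) ^ n - ((4 - sqrt 15) / 12) ^ n)) /
     (((4 + sqrt 15) / 12) ^ n + ((4 - sqrt 15) / 12) ^ n + 2 * (1 / 12) ^ n)"

end

theory Submission
  imports Defs
begin

text \<open>
  \<open>Q n\<close> is a cycle of length \<open>6n\<close> with the diameters at every third vertex. The antipodal map
  splits functions on it into even and odd ones: on the even part the combinatorial Laplacian is that
  of a plain cycle of length \<open>3n\<close>, on the odd part it is an antiperiodic Jacobi operator with
  diagonal 4, 2, 2. Both have explicit Green functions, and half their signed sum is a Green function
  of \<open>Q n\<close>, which gives the resistances. Conjugating by the square roots of the degrees turns the same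
  Green functions into the inverse of \<open>L_S\<close> and of \<open>L_A\<close> plus the projection onto its kernel, so
  the reciprocal eigenvalue sums are the traces of these inverses.
\<close>

section \<open>Characteristic polynomials of real symmetric matrices\<close>

text \<open>No eigenvalue is ever computed. Two numbers carry both sides:
  \<open>trace_anti n\<close>, the degree-weighted trace of the odd Green function, and
  \<open>sum_cyc n\<close>, the degree-weighted double sum of the even one. The Kirchhoff side is
  \<open>14 * n * trace_anti n - 2 * sum_cyc n\<close>, where \<open>14 * n\<close> is the sum of
  all degrees; on the spectral side the reciprocal sums are \<open>trace_anti n\<close> for
  \<open>L_S\<close> and \<open>- sum_cyc n / (7 * n)\<close> for \<open>L_A\<close>. What remains
  is to evaluate the two numbers. The obstacle is the eigenvalue 0 of \<open>L_A\<close>. Adding a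
  rank-one projection moves it to 1 and keeps the other eigenvalues, but this projection is weighted
  by degrees, whereas the Green function of the cycle misses the unit source by a uniform constant.
  Recentring it by degree-weighted means turns the uniform defect into one proportional to the
  degree, and that is where \<open>sum_cyc n\<close> enters the trace.\<close>

lemma symmetric_real_root_real:
  fixes A :: "real mat"
  assumes A: "A \<in> carrier_mat n n"
    and sym: "\<And>i j. i < n \<Longrightarrow> j < n \<Longrightarrow> A $$ (i, j) = A $$ (j, i)"
    and root: "poly (char_poly (map_mat complex_of_real A)) z = 0"
  shows "z \<in> \<real>"
proof -
  let ?A = "map_mat complex_of_real A"
  have cA: "?A \<in> carrier_mat n n" using A by simp
  from root eigenvalue_root_char_poly[OF cA] obtain v where "eigenvector ?A v z"
    unfolding eigenvalue_def by blast
  hence v: "v \<in> carrier_vec n" "v \<noteq> 0\<^sub>v n" and Av: "?A *\<^sub>v v = z \<cdot>\<^sub>v v"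
    using cA by (auto simp: eigenvector_def)
  have eq: "(\<Sum>j<n. of_real (A $$ (i, j)) * v $ j) = z * v $ i" if "i < n" for i
    using arg_cong[OF Av, of "\<lambda>u. u $ i"] that A v
    by (simp add: scalar_prod_def lessThan_atLeast0)
  define S where "S = (\<Sum>i<n. \<Sum>j<n. cnj (v $ i) * of_real (A $$ (i, j)) * v $ j)"
  define T where "T = (\<Sum>i<n. (cmod (v $ i))\<^sup>2)"
  have "S = (\<Sum>i<n. cnj (v $ i) * (z * v $ i))"
    unfolding S_def by (intro sum.cong refl) (simp add: eq[symmetric] sum_distrib_left mult.assoc)
  also have "\<dots> = z * of_real T"
    unfolding T_def of_real_sum sum_distrib_left
    by (intro sum.cong refl) (simp add: complex_norm_square mult_ac del: of_real_power)
  finally have S: "S = z * of_real T" .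
  have "cnj S = (\<Sum>i<n. \<Sum>j<n. v $ i * of_real (A $$ (i, j)) * cnj (v $ j))"
    by (simp add: S_def)
  also have "\<dots> = (\<Sum>j<n. \<Sum>i<n. v $ i * of_real (A $$ (i, j)) * cnj (v $ j))"
    by (rule sum.swap)
  also have "\<dots> = S"
    unfolding S_def by (intro sum.cong refl) (simp add: sym mult_ac)
  finally have cS: "cnj S = S" .
  from v obtain i where i: "i < n" "v $ i \<noteq> 0" by force
  have "T > 0" unfolding T_def by (rule sum_pos2[of _ i]) (use i in auto)
  hence "cnj z = z" using cS unfolding S by simp
  thus ?thesis by (simp add: Reals_cnj_iff)
qed

text \<open>The complex factorisation has only real roots, so it descends to the reals by
  injectivity of the embedding. This is what lets \<open>proots\<close>, which sees real roots only,
  return all \<open>n\<close> eigenvalues.\<close>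

lemma char_poly_symmetric_real_splits:
  fixes A :: "real mat"
  assumes A: "A \<in> carrier_mat n n"
    and sym: "\<And>i j. i < n \<Longrightarrow> j < n \<Longrightarrow> A $$ (i, j) = A $$ (j, i)"
  obtains as where "char_poly A = (\<Prod>a\<leftarrow>as. [:- a, 1:])" "length as = n"
proof -
  let ?A = "map_mat complex_of_real A"
  have "?A \<in> carrier_mat n n" using A by simp
  from char_poly_factorized[OF this] obtain cs where
    cs: "char_poly ?A = (\<Prod>a\<leftarrow>cs. [:- a, 1:])" "length cs = n" by blast
  have "c \<in> \<real>" if "c \<in> set cs" for c
  proof (rule symmetric_real_root_real[OF A sym])
    show "poly (char_poly ?A) c = 0" unfolding cs(1) poly_prod_list
      using that by (force simp: prod_list_zero_iff)
  qed
  hence re: "map (of_real \<circ> Re) cs = cs" by (intro map_idI) auto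
  interpret h: map_poly_inj_idom_hom complex_of_real ..
  have "map_poly complex_of_real (char_poly A) = char_poly ?A"
    by (rule of_real_hom.char_poly_hom[OF A, symmetric])
  also have "\<dots> = (\<Prod>a\<leftarrow>map (of_real \<circ> Re) cs. [:- a, 1:])" unfolding cs(1) re ..
  also have "\<dots> = map_poly complex_of_real (\<Prod>a\<leftarrow>map Re cs. [:- a, 1:])"
    by (simp add: h.hom_prod_list o_def hom_distribs)
  finally have "char_poly A = (\<Prod>a\<leftarrow>map Re cs. [:- a, 1:])" by simp
  thus ?thesis using cs(2) by (intro that[of "map Re cs"]) auto
qed

lemma proots_prod_linear:
  "proots (\<Prod>a\<leftarrow>as. [:- a, 1:]) = mset (as :: 'a :: idom list)"
proof (induction as)
  case (Cons a as)
  have "(\<Prod>a\<leftarrow>as. [:- a, 1:]) \<noteq> 0" by (auto simp: prod_list_zero_iff)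
  hence "proots ([:- a, 1:] * (\<Prod>a\<leftarrow>as. [:- a, 1:])) = {#a#} + mset as"
    by (subst proots_mult) (simp_all only: Cons.IH proots_linear_factor, auto)
  thus ?case by (simp only: list.map prod_list.Cons mset.simps) simp
qed simp

text \<open>The logarithmic derivative of a split polynomial, taken at 0.\<close>

lemma poly_pderiv_prod_linear:
  fixes as :: "'a :: field list"
  assumes "0 \<notin> set as"
  defines "p \<equiv> \<Prod>a\<leftarrow>as. [:- a, 1:]"
  shows "poly (pderiv p) 0 = - poly p 0 * (\<Sum>a\<leftarrow>as. 1 / a)"
  using assms(1) unfolding p_def
proof (induction as)
  case (Cons a as)
  let ?q = "\<Prod>a\<leftarrow>as. [:- a, 1:]"
  have "poly (pderiv ([:- a, 1:] * ?q)) 0 = - a * poly (pderiv ?q) 0 + poly ?q 0"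
    by (simp only: pderiv_mult poly_add poly_mult) (simp add: pderiv_pCons)
  thus ?case using Cons by (simp add: field_simps)
qed simp

lemma trace_adj_mat:
  assumes A: "(A :: 'a :: comm_ring_1 mat) \<in> carrier_mat n n"
  shows "(\<Sum>i<n. adj_mat A $$ (i, i)) = (\<Sum>i<n. det (mat_delete A i i))"
  using A by (intro sum.cong refl) (simp add: adj_mat_def cofactor_def flip: mult_2)

text \<open>The reciprocal sum is \<open>- p'(0) / p(0)\<close> for the characteristic polynomial
  \<open>p\<close>. Up to sign, \<open>p(0)\<close> is \<open>det A\<close> and \<open>p'(0)\<close>
  is the sum of the principal minors of size \<open>n - 1\<close>, that is, the trace of the
  adjugate \<open>det A * B\<close>.\<close>

lemma sum_inverse_proots_char_poly:
  fixes A B :: "real mat"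
  assumes A: "A \<in> carrier_mat n n" and B: "B \<in> carrier_mat n n"
    and sym: "\<And>i j. i < n \<Longrightarrow> j < n \<Longrightarrow> A $$ (i, j) = A $$ (j, i)"
    and inv: "A * B = 1\<^sub>m n"
  shows "0 \<notin># proots (char_poly A)"
    and "(\<Sum>x\<in>#proots (char_poly A). 1 / x) = (\<Sum>i<n. B $$ (i, i))"
proof -
  obtain as where as: "char_poly A = (\<Prod>a\<leftarrow>as. [:- a, 1:])" "length as = n"
    using char_poly_symmetric_real_splits[OF A sym] by blast
  have mset: "proots (char_poly A) = mset as" unfolding as(1) by (rule proots_prod_linear)
  have "det A * det B = 1" using det_mult[OF A B] inv by simp
  hence detA: "det A \<noteq> 0" by auto
  have minus: "poly (char_poly C) 0 = (-1) ^ m * det C" if C: "C \<in> carrier_mat m m" for C :: "real mat" and m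
  proof -
    have "- char_matrix C 0 = (-1) \<cdot>\<^sub>m C"
      using C by (intro eq_matI) (auto simp: char_matrix_def)
    thus ?thesis using C by (simp add: char_poly_matrix[OF C] det_smult)
  qed
  have p0: "poly (char_poly A) 0 = (-1) ^ n * det A" by (rule minus[OF A])
  have 0: "0 \<notin> set as"
  proof
    assume "0 \<in> set as"
    hence "poly (char_poly A) 0 = 0" unfolding as(1) poly_prod_list
      by (force simp: prod_list_zero_iff)
    thus False using p0 detA by simp
  qed
  thus "0 \<notin># proots (char_poly A)" unfolding mset by simp
  have "poly (pderiv (char_poly A)) 0 = (\<Sum>i<n. (-1) ^ (n - 1) * det (mat_delete A i i))"
    unfolding pderiv_char_poly[OF A] poly_sum
    by (intro sum.cong refl minus) (use A in auto)
  also have "\<dots> = (-1) ^ (n - 1) * (\<Sum>i<n. adj_mat A $$ (i, i))"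
    unfolding trace_adj_mat[OF A] by (simp add: sum_distrib_left)
  also have "adj_mat A = det A \<cdot>\<^sub>m B"
  proof -
    have "adj_mat A = adj_mat A * (A * B)" unfolding inv using adj_mat(1)[OF A] by simp
    also have "\<dots> = (adj_mat A * A) * B" using adj_mat(1)[OF A] A B by simp
    also have "\<dots> = det A \<cdot>\<^sub>m B" unfolding adj_mat(3)[OF A]
      using B by (subst mult_smult_assoc_mat[of _ n n _ n]) auto
    finally show ?thesis .
  qed
  also have "(\<Sum>i<n. (det A \<cdot>\<^sub>m B) $$ (i, i)) = det A * (\<Sum>i<n. B $$ (i, i))"
    using B by (simp add: sum_distrib_left)
  finally have d: "poly (pderiv (char_poly A)) 0 = (-1) ^ (n - 1) * (det A * (\<Sum>i<n. B $$ (i, i)))" .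
  have e: "poly (pderiv (char_poly A)) 0 = - ((-1) ^ n * det A) * (\<Sum>a\<leftarrow>as. 1 / a)"
    using poly_pderiv_prod_linear[OF 0] p0 unfolding as(1) by simp
  have "(\<Sum>a\<leftarrow>as. 1 / a) = (\<Sum>i<n. B $$ (i, i))"
  \<comment> \<open>At \<open>n = 0\<close> the truncated exponent \<open>n - 1\<close> breaks the
    sign comparison between \<open>d\<close> and \<open>e\<close>, but both sums are empty.\<close>
  proof (cases n)
    case 0
    thus ?thesis using as(2) by simp
  next
    case (Suc m)
    thus ?thesis using d e detA by simp
  qed
  thus "(\<Sum>x\<in>#proots (char_poly A). 1 / x) = (\<Sum>i<n. B $$ (i, i))"
    unfolding mset by (simp flip: sum_mset_sum_list)
qed

section \<open>Rank-one deflation of an eigenvalue 0\<close>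

text \<open>Sylvester's determinant identity in rank one: the block matrix with identity diagonal
  blocks and off-diagonal blocks \<open>U\<close>, \<open>V\<close> factors into triangular ones in
  two ways, with Schur complement \<open>1 - V * U\<close> or \<open>1 - U * V\<close>.\<close>

lemma det_one_minus_rank_one:
  fixes U V :: "'a :: field mat"
  assumes U: "U \<in> carrier_mat n 1" and V: "V \<in> carrier_mat 1 n"
  shows "det (1\<^sub>m n - U * V) = 1 - (V * U) $$ (0, 0)"
proof -
  let ?N = "four_block_mat (1\<^sub>m n) U V (1\<^sub>m 1)"
  let ?W = "1\<^sub>m 1 - V * U"
  have N: "?N \<in> carrier_mat (n + 1) (n + 1)" using U V by auto
  have L: "four_block_mat (1\<^sub>m n) (0\<^sub>m n 1) V (1\<^sub>m 1) \<in> carrier_mat (n + 1) (n + 1)"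
    using U V by auto
  have R: "four_block_mat (1\<^sub>m n) U (0\<^sub>m 1 n) ?W \<in> carrier_mat (n + 1) (n + 1)"
    using U V by auto
  have R': "four_block_mat (1\<^sub>m n - U * V) U (0\<^sub>m 1 n) (1\<^sub>m 1) \<in> carrier_mat (n + 1) (n + 1)"
    using U V by auto
  have VU: "V * U \<in> carrier_mat 1 1" using U V by simp
  have UV: "U * V \<in> carrier_mat n n" using U V by simp
  have "four_block_mat (1\<^sub>m n) (0\<^sub>m n 1) V (1\<^sub>m 1) * four_block_mat (1\<^sub>m n) U (0\<^sub>m 1 n) ?W = ?N"
    using U V VU
    by (subst mult_four_block_mat[of _ n n _ 1 _ 1 _ _ n _ 1]) (auto intro!: eq_matI arg_cong4[of _ _ _ _ _ _ _ _ four_block_mat])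
  hence 1: "det ?N = det (four_block_mat (1\<^sub>m n) (0\<^sub>m n 1) V (1\<^sub>m 1)) * det (four_block_mat (1\<^sub>m n) U (0\<^sub>m 1 n) ?W)"
    using det_mult[OF L R] by simp
  have "four_block_mat (1\<^sub>m n - U * V) U (0\<^sub>m 1 n) (1\<^sub>m 1) * four_block_mat (1\<^sub>m n) (0\<^sub>m n 1) V (1\<^sub>m 1) = ?N"
    using U V UV
    by (subst mult_four_block_mat[of _ n n _ 1 _ 1 _ _ n _ 1]) (auto intro!: eq_matI arg_cong4[of _ _ _ _ _ _ _ _ four_block_mat])
  hence 2: "det ?N = det (four_block_mat (1\<^sub>m n - U * V) U (0\<^sub>m 1 n) (1\<^sub>m 1)) * det (four_block_mat (1\<^sub>m n) (0\<^sub>m n 1) V (1\<^sub>m 1))"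
    using det_mult[OF R' L] by simp
  have a: "det (four_block_mat (1\<^sub>m n) (0\<^sub>m n 1) V (1\<^sub>m 1)) = 1"
    by (subst det_four_block_mat_upper_right_zero[of _ n _ 1]) (use V in auto)
  have b: "det (four_block_mat (1\<^sub>m n) U (0\<^sub>m 1 n) ?W) = det ?W"
    by (subst det_four_block_mat_lower_left_zero[of _ n _ 1]) (use U V in auto)
  have c: "det (four_block_mat (1\<^sub>m n - U * V) U (0\<^sub>m 1 n) (1\<^sub>m 1)) = det (1\<^sub>m n - U * V)"
    by (subst det_four_block_mat_lower_left_zero[of _ n _ 1]) (use U V in auto)
  have "det ?W = 1 - (V * U) $$ (0, 0)" by (subst det_single) (use U V in auto)
  thus ?thesis using 1 2 a b c by simp
qed

text \<open>Since \<open>(x - A) * U = x * U\<close>, the matrix \<open>x - A - U * V\<close>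
  factors as \<open>(x - A) * (1 - U * V / x)\<close>, whose second factor has determinant
  \<open>1 - 1 / x\<close>. One eigenvalue thus moves from 0 to 1 and the others stay.\<close>

lemma char_poly_deflation:
  fixes A U V :: "'a :: field_char_0 mat"
  assumes A: "A \<in> carrier_mat n n" and U: "U \<in> carrier_mat n 1" and V: "V \<in> carrier_mat 1 n"
    and null: "A * U = 0\<^sub>m n 1" and unit: "(V * U) $$ (0, 0) = 1"
  shows "[:0, 1:] * char_poly (A + U * V) = [:-1, 1:] * char_poly A"
proof -
  let ?M = "A + U * V"
  have M: "?M \<in> carrier_mat n n" using A U V by simp
  have *: "x * poly (char_poly ?M) x = (x - 1) * poly (char_poly A) x" if x: "x \<noteq> 0" for x
  proof -
    define C where "C = x \<cdot>\<^sub>m 1\<^sub>m n - A"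
    have C: "C \<in> carrier_mat n n" using A unfolding C_def by (intro minus_carrier_mat) auto
    have cA: "- char_matrix A x = C"
      using A by (intro eq_matI) (auto simp: char_matrix_def C_def)
    have "C * U = x \<cdot>\<^sub>m U"
      unfolding C_def using A U null
      by (subst minus_mult_distrib_mat[of _ n n _ _ 1]) (auto simp: mult_smult_assoc_mat[of _ n n _ 1])
    hence "C * (U * V) = x \<cdot>\<^sub>m (U * V)"
      using C U V by (simp add: mult_smult_assoc_mat[of _ n 1 _ n] flip: assoc_mult_mat[of _ n n _ 1 _ n])
    hence "C * ((1 / x) \<cdot>\<^sub>m (U * V)) = U * V"
      using C U V x by (subst mult_smult_distrib[of _ n n _ n]) (auto intro!: eq_matI)
    hence "C * ((1 / x) \<cdot>\<^sub>m U * V) = U * V"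
      using U V by (simp add: mult_smult_assoc_mat[of _ n 1 _ n])
    hence "C * (1\<^sub>m n - (1 / x) \<cdot>\<^sub>m U * V) = C - U * V"
      using C U V by (subst mult_minus_distrib_mat[of _ n n _ n]) auto
    also have "\<dots> = - char_matrix ?M x"
      using A U V by (intro eq_matI) (auto simp: char_matrix_def C_def)
    finally have "det (- char_matrix ?M x) = det C * det (1\<^sub>m n - (1 / x) \<cdot>\<^sub>m U * V)"
      using det_mult[OF C, of "1\<^sub>m n - (1 / x) \<cdot>\<^sub>m U * V"] U V
      by (metis minus_carrier_mat mult_carrier_mat smult_carrier_mat)
    also have "det (1\<^sub>m n - (1 / x) \<cdot>\<^sub>m U * V) = 1 - (V * ((1 / x) \<cdot>\<^sub>m U)) $$ (0, 0)"
      by (rule det_one_minus_rank_one) (use U V in auto)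
    also have "\<dots> = 1 - 1 / x"
      using unit U V by (simp add: mult_smult_distrib[of _ 1 n _ 1])
    finally show ?thesis
      using x by (simp add: char_poly_matrix[OF M] char_poly_matrix[OF A] cA field_simps)
  qed
  \<comment> \<open>The pointwise identity is available only for nonzero \<open>x\<close>. One more
    factor \<open>x\<close> makes it trivial at 0, and is cancelled at the end.\<close>
  have "[:0, 1:] * ([:0, 1:] * char_poly ?M) = [:0, 1:] * ([:-1, 1:] * char_poly A)"
  proof (rule poly_eq_poly_eq_iff[THEN iffD1], rule ext)
    fix x
    have "x * (x * poly (char_poly ?M) x) = x * ((x - 1) * poly (char_poly A) x)"
      using *[of x] by (cases "x = 0") simp_all
    thus "poly ([:0, 1:] * ([:0, 1:] * char_poly ?M)) x = poly ([:0, 1:] * ([:-1, 1:] * char_poly A)) x"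
      by (simp add: algebra_simps)
  qed
  thus ?thesis by simp
qed

section \<open>Green functions and effective resistance\<close>

definition laplace :: "'v ugraph \<Rightarrow> ('v \<Rightarrow> real) \<Rightarrow> 'v \<Rightarrow> real" where
  "laplace G \<phi> x = (\<Sum>y\<in>nbrs G x. \<phi> x - \<phi> y)"

lemma laplace_alt: "laplace G \<phi> x = real (vdeg G x) * \<phi> x - (\<Sum>y\<in>nbrs G x. \<phi> y)"
  by (simp add: laplace_def vdeg_def sum_subtractf)

lemma laplace_diff: "laplace G (\<lambda>z. \<phi> z - \<psi> z) x = laplace G \<phi> x - laplace G \<psi> x"
  by (simp add: laplace_alt sum_subtractf algebra_simps)

lemma finite_nbrs: "finite (fst G) \<Longrightarrow> finite (nbrs G x)"
  by (simp add: nbrs_def)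

lemma laplace_self_adjoint:
  assumes "finite (fst G)"
  shows "(\<Sum>x\<in>fst G. \<psi> x * laplace G \<phi> x) = (\<Sum>x\<in>fst G. \<phi> x * laplace G \<psi> x)"
proof -
  have "(\<Sum>x\<in>fst G. \<Sum>y\<in>nbrs G x. \<psi> x * \<phi> y) = (\<Sum>x\<in>fst G. \<Sum>y\<in>nbrs G x. \<phi> x * \<psi> y)"
    unfolding nbrs_def
    by (subst sum.swap_restrict[OF assms assms]) (simp add: insert_commute mult.commute)
  thus ?thesis
    by (simp add: laplace_alt algebra_simps sum_subtractf sum_distrib_left)
qed

text \<open>The defect \<open>c\<close> cancels in the difference of the columns at \<open>u\<close>
  and \<open>v\<close>, so this difference is a unit flow potential.\<close>

lemma eff_resistance_green:
  assumes fin: "finite (fst G)"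
    and green: "\<And>x y. x \<in> fst G \<Longrightarrow> y \<in> fst G \<Longrightarrow>
      laplace G (\<lambda>z. \<Gamma> z y) x = (if x = y then 1 else 0) - c"
    and u: "u \<in> fst G" and v: "v \<in> fst G"
  shows "eff_resistance G u v = \<Gamma> u u - \<Gamma> u v - \<Gamma> v u + \<Gamma> v v"
  unfolding eff_resistance_def
proof (rule the_equality)
  let ?\<phi> = "\<lambda>x. \<Gamma> x u - \<Gamma> x v"
  have "unit_flow_potential G u v ?\<phi>"
    unfolding unit_flow_potential_def laplace_def[of G ?\<phi>, symmetric]
    by (simp add: laplace_diff green u v)
  thus "\<exists>\<phi>. unit_flow_potential G u v \<phi> \<and> \<Gamma> u u - \<Gamma> u v - \<Gamma> v u + \<Gamma> v v = \<phi> u - \<phi> v"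
    by (intro exI[of _ ?\<phi>]) simp
next
  fix r assume "\<exists>\<phi>. unit_flow_potential G u v \<phi> \<and> r = \<phi> u - \<phi> v"
  then obtain \<phi> where \<phi>: "unit_flow_potential G u v \<phi>" and r: "r = \<phi> u - \<phi> v" by blast
  \<comment> \<open>Uniqueness: pairing an arbitrary potential with the column of
    \<open>\<Gamma>\<close> at \<open>y\<close> and using self-adjointness recovers \<phi> up to an
    additive constant, which drops out of the potential difference.\<close>
  have *: "\<phi> y - c * (\<Sum>x\<in>fst G. \<phi> x) = \<Gamma> u y - \<Gamma> v y" if y: "y \<in> fst G" for y
  proof -
    have "(\<Sum>x\<in>fst G. \<phi> x * laplace G (\<lambda>z. \<Gamma> z y) x) =
        (\<Sum>x\<in>fst G. (if x = y then \<phi> x else 0) - c * \<phi> x)"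
      by (intro sum.cong refl) (simp add: green y algebra_simps)
    also have "\<dots> = \<phi> y - c * (\<Sum>x\<in>fst G. \<phi> x)"
      using fin y by (simp add: sum_subtractf sum_distrib_left)
    finally have 1: "(\<Sum>x\<in>fst G. \<phi> x * laplace G (\<lambda>z. \<Gamma> z y) x) = \<phi> y - c * (\<Sum>x\<in>fst G. \<phi> x)" .
    have "(\<Sum>x\<in>fst G. \<Gamma> x y * laplace G \<phi> x) =
        (\<Sum>x\<in>fst G. (if x = u then \<Gamma> x y else 0) - (if x = v then \<Gamma> x y else 0))"
      using \<phi> unfolding unit_flow_potential_def laplace_def[of G \<phi>, symmetric]
      by (intro sum.cong refl) auto
    also have "\<dots> = \<Gamma> u y - \<Gamma> v y"
      using fin u v by (simp add: sum_subtractf)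
    finally show ?thesis
      using laplace_self_adjoint[OF fin, of \<phi> "\<lambda>z. \<Gamma> z y"] 1 by simp
  qed
  show "r = \<Gamma> u u - \<Gamma> u v - \<Gamma> v u + \<Gamma> v v"
    unfolding r using *[OF u] *[OF v] by simp
qed

text \<open>The resistance formula vanishes on the diagonal, so the sum may run over all pairs. Its
  two diagonal terms then split off the total degree, and its two mixed terms agree after exchanging
  the summations.\<close>

lemma mult_degree_kirchhoff_green:
  assumes fin: "finite (fst G)"
    and green: "\<And>x y. x \<in> fst G \<Longrightarrow> y \<in> fst G \<Longrightarrow>
      laplace G (\<lambda>z. \<Gamma> z y) x = (if x = y then 1 else 0) - c"
  shows "mult_degree_kirchhoff G =
    (\<Sum>u\<in>fst G. real (vdeg G u)) * (\<Sum>u\<in>fst G. real (vdeg G u) * \<Gamma> u u) -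
    (\<Sum>u\<in>fst G. \<Sum>v\<in>fst G. real (vdeg G u) * real (vdeg G v) * \<Gamma> u v)"
proof -
  let ?d = "\<lambda>u. real (vdeg G u)"
  let ?V = "fst G"
  have "(\<Sum>v\<in>?V - {u}. ?d u * ?d v * eff_resistance G u v) =
      (\<Sum>v\<in>?V. ?d u * ?d v * (\<Gamma> u u - \<Gamma> u v - \<Gamma> v u + \<Gamma> v v))" if u: "u \<in> ?V" for u
  proof -
    have "(\<Sum>v\<in>?V - {u}. ?d u * ?d v * eff_resistance G u v) =
        (\<Sum>v\<in>?V - {u}. ?d u * ?d v * (\<Gamma> u u - \<Gamma> u v - \<Gamma> v u + \<Gamma> v v))"
      using eff_resistance_green[OF fin green] u by (intro sum.cong) auto
    also have "\<dots> = (\<Sum>v\<in>?V. ?d u * ?d v * (\<Gamma> u u - \<Gamma> u v - \<Gamma> v u + \<Gamma> v v))"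
      using fin by (intro sum.mono_neutral_left) auto
    finally show ?thesis .
  qed
  hence "2 * mult_degree_kirchhoff G =
      (\<Sum>u\<in>?V. \<Sum>v\<in>?V. ?d u * ?d v * (\<Gamma> u u - \<Gamma> u v - \<Gamma> v u + \<Gamma> v v))"
    unfolding mult_degree_kirchhoff_def by simp
  also have "\<dots> = (\<Sum>u\<in>?V. \<Sum>v\<in>?V. ?d v * (?d u * \<Gamma> u u)) + (\<Sum>u\<in>?V. \<Sum>v\<in>?V. ?d u * (?d v * \<Gamma> v v))
      - (\<Sum>u\<in>?V. \<Sum>v\<in>?V. ?d u * ?d v * \<Gamma> u v) - (\<Sum>u\<in>?V. \<Sum>v\<in>?V. ?d u * ?d v * \<Gamma> v u)"
    by (simp add: algebra_simps sum.distrib sum_subtractf)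
  also have "(\<Sum>u\<in>?V. \<Sum>v\<in>?V. ?d u * ?d v * \<Gamma> v u) = (\<Sum>u\<in>?V. \<Sum>v\<in>?V. ?d u * ?d v * \<Gamma> u v)"
    by (subst sum.swap) (simp add: mult_ac)
  also have "(\<Sum>u\<in>?V. \<Sum>v\<in>?V. ?d v * (?d u * \<Gamma> u u)) = (\<Sum>u\<in>?V. ?d u) * (\<Sum>u\<in>?V. ?d u * \<Gamma> u u)"
    by (subst sum.swap) (simp add: sum_product)
  also have "(\<Sum>u\<in>?V. \<Sum>v\<in>?V. ?d u * (?d v * \<Gamma> v v)) = (\<Sum>u\<in>?V. ?d u) * (\<Sum>u\<in>?V. ?d u * \<Gamma> u u)"
    by (simp add: sum_product)
  finally show ?thesis by simp
qed

text \<open>This is the factorisation of the normalized Laplacian as the combinatorial one with the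
  inverse square roots of the degrees on both sides, applied to a function rescaled by the square
  roots.\<close>

lemma norm_laplacian_mult:
  assumes fin: "finite (fst G)" and u: "u \<in> fst G" and loop: "\<And>v. {v} \<notin> snd G"
  shows "(\<Sum>v\<in>fst G. norm_laplacian G u v * (sqrt (real (vdeg G v)) * \<phi> v)) =
    laplace G \<phi> u / sqrt (real (vdeg G u))"
proof -
  let ?d = "\<lambda>u. real (vdeg G u)"
  have uu: "u \<notin> nbrs G u" using loop[of u] by (auto simp: nbrs_def)
  have "(\<Sum>v\<in>fst G. norm_laplacian G u v * (sqrt (?d v) * \<phi> v)) =
      (\<Sum>v\<in>fst G. (if v = u then sqrt (?d v) * \<phi> v else 0) - (if v \<in> nbrs G u then \<phi> v / sqrt (?d u) else 0))"
  proof (intro sum.cong refl)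
    fix v assume v: "v \<in> fst G"
    show "norm_laplacian G u v * (sqrt (?d v) * \<phi> v) =
      (if v = u then sqrt (?d v) * \<phi> v else 0) - (if v \<in> nbrs G u then \<phi> v / sqrt (?d u) else 0)"
    proof (cases "v \<in> nbrs G u")
      case True
      hence "u \<in> nbrs G v" using u by (simp add: nbrs_def insert_commute)
      hence "vdeg G v > 0" using finite_nbrs[OF fin] by (auto simp: vdeg_def card_gt_0_iff)
      thus ?thesis using True uu by (auto simp: norm_laplacian_def nbrs_def real_sqrt_mult)
    next
      case False
      thus ?thesis using v by (auto simp: norm_laplacian_def nbrs_def)
    qed
  qed
  also have "\<dots> = sqrt (?d u) * \<phi> u - (\<Sum>v\<in>nbrs G u. \<phi> v) / sqrt (?d u)"
  proof -
    have "fst G \<inter> nbrs G u = nbrs G u" by (auto simp: nbrs_def)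
    thus ?thesis using fin u
      by (simp add: sum_subtractf sum_divide_distrib flip: sum.inter_restrict)
  qed
  \<comment> \<open>At an isolated vertex both sides are 0, because division by 0 gives 0.\<close>
  also have "\<dots> = laplace G \<phi> u / sqrt (?d u)"
    by (cases "vdeg G u = 0") (simp_all add: laplace_alt field_simps)
  finally show ?thesis .
qed

text \<open>Positivity of the spectrum rests on this maximum principle.\<close>

lemma laplace_at_extremum:
  assumes "\<And>z. z \<in> nbrs G u \<Longrightarrow> \<bar>\<phi> z\<bar> \<le> \<bar>\<phi> u\<bar>"
  shows "0 \<le> \<phi> u * laplace G \<phi> u"
  unfolding laplace_def sum_distrib_left
proof (rule sum_nonneg)
  fix z assume "z \<in> nbrs G u"
  hence "\<bar>\<phi> u\<bar> * \<bar>\<phi> z\<bar> \<le> \<bar>\<phi> u\<bar> * \<bar>\<phi> u\<bar>" by (intro mult_left_mono assms) auto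
  hence "\<phi> u * \<phi> z \<le> \<phi> u * \<phi> u" by (metis abs_mult abs_mult_self_eq abs_le_D1)
  thus "0 \<le> \<phi> u * (\<phi> u - \<phi> z)" by (simp add: algebra_simps)
qed

section \<open>Green functions on the integers\<close>

lemma mod_add_one_int:
  fixes k N :: int
  assumes "N > 1"
  shows "(k + 1) mod N = (if k mod N = N - 1 then 0 else k mod N + 1)"
    and "(k - 1) mod N = (if k mod N = 0 then N - 1 else k mod N - 1)"
proof -
  have 1: "0 \<le> k mod N" "k mod N < N" using assms by auto
  show "(k + 1) mod N = (if k mod N = N - 1 then 0 else k mod N + 1)"
  proof (cases "k mod N = N - 1")
    case True
    thus ?thesis by (metis mod_add_left_eq diff_add_cancel mod_self)
  next
    case False
    hence "(k mod N + 1) mod N = k mod N + 1" using 1 by (intro mod_pos_pos_trivial) auto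
    thus ?thesis using False by (simp add: mod_add_left_eq)
  qed
  show "(k - 1) mod N = (if k mod N = 0 then N - 1 else k mod N - 1)"
  proof (cases "k mod N = 0")
    case True
    have "(k - 1) mod N = (k - 1 + N) mod N" by simp
    also have "k - 1 + N = k + (N - 1)" by simp
    also have "(k + (N - 1)) mod N = (k mod N + (N - 1)) mod N" by (rule mod_add_left_eq[symmetric])
    also have "\<dots> = N - 1" unfolding True using assms by (subst mod_pos_pos_trivial) auto
    finally show ?thesis using True by simp
  next
    case False
    hence "(k mod N - 1) mod N = k mod N - 1" using 1 by (intro mod_pos_pos_trivial) auto
    thus ?thesis using False by (simp add: mod_diff_left_eq)
  qed
qed

text \<open>The constant \<open>1 / N\<close> in \<open>cyc_green_laplace\<close> is unavoidable: a Laplacian has mean value 0 on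
  the cycle.\<close>

definition cyc_green :: "int \<Rightarrow> int \<Rightarrow> real" where
  "cyc_green N k = - of_int (k mod N * (N - k mod N)) / of_int (2 * N)"

lemma cyc_green_laplace:
  assumes "N > 1"
  shows "2 * cyc_green N k - cyc_green N (k + 1) - cyc_green N (k - 1) =
    (if N dvd k then 1 else 0) - 1 / of_int N"
proof -
  define r where "r = k mod N"
  \<comment> \<open>The parabola \<open>r * (N - r)\<close> has its kink, hence the unit source,
    only at \<open>r = 0\<close>. At \<open>r = N - 1\<close> the successor wraps to 0, where the
    value is the one the parabola takes at \<open>N\<close>.\<close>
  have "r = 0 \<or> N = r + 1 \<and> r > 0 \<or> 0 < r \<and> r < N - 1"
    using pos_mod_bound[of N k] pos_mod_sign[of N k] assms unfolding r_def by linarith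
  thus ?thesis
    using assms unfolding cyc_green_def mod_add_one_int[OF assms] dvd_eq_mod_eq_0 r_def[symmetric]
    by (auto simp: field_simps)
qed

lemma cyc_green_periodic: "cyc_green N (k + N) = cyc_green N k"
  by (simp add: cyc_green_def)

section \<open>Antiperiodic Green function on the rungs\<close>

definition par :: "int \<Rightarrow> real" where
  "par k = (if even k then 1 else - 1)"

lemma par_add_one: "par (k + 1) = - par k" "par (k - 1) = - par k"
  by (auto simp: par_def)

text \<open>The unit source for \<open>n\<close>-antiperiodic functions: a point mass at 0 that
  changes sign with each turn.\<close>

definition anti_delta :: "int \<Rightarrow> int \<Rightarrow> real" where
  "anti_delta n m = (if n dvd m then par (m div n) else 0)"

lemma anti_delta_shift: "n > 0 \<Longrightarrow> anti_delta n (m + n) = - anti_delta n m"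
  by (auto simp: anti_delta_def par_add_one)

lemma anti_delta_small: "\<bar>m\<bar> < n \<Longrightarrow> anti_delta n m = (if m = 0 then 1 else 0)"
  using dvd_imp_le_int[of m n] by (auto simp: anti_delta_def par_def)

text \<open>The vertices between two rungs have degree 2, so eliminating them leaves the recurrence
  \<open>H (m + 1) + H (m - 1) = 8 * H m\<close> on the rungs, with characteristic roots \<open>4 + sqrt 15\<close> and
  \<open>4 - sqrt 15\<close>. On one period its \<open>n\<close>-antiperiodic Green function is \<open>rung_profile\<close>.\<close>

definition rung_profile :: "int \<Rightarrow> int \<Rightarrow> real" where
  "rung_profile n k = ((4 - sqrt 15) ^ nat k - (4 - sqrt 15) ^ nat n * (4 + sqrt 15) ^ nat k) /
     (2 * sqrt 15 * (1 + (4 - sqrt 15) ^ nat n))"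

definition rung_green :: "int \<Rightarrow> int \<Rightarrow> real" where
  "rung_green n m = par (m div n) * rung_profile n (m mod n)"

lemma sqrt15_prod: "(4 - sqrt 15) * (4 + sqrt 15) = 1"
  by (simp add: algebra_simps)

lemma sqrt15_less: "sqrt 15 < 4"
  by (rule real_less_lsqrt) auto

lemma sqrt15_pow_pos: "(4 - sqrt 15) ^ k > 0"
  using sqrt15_less by simp

text \<open>The roots multiply to 1, so \<open>(4 - sqrt 15) ^ n * (4 + sqrt 15) ^ k\<close> equals
  \<open>(4 - sqrt 15) ^ (n - k)\<close>, and reflection swaps the two powers in the numerator. This
  is the boundary condition that glues consecutive periods with a change of sign.\<close>

lemma rung_profile_reflect:
  assumes "0 \<le> k" "k \<le> n"
  shows "rung_profile n (n - k) = - rung_profile n k"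
proof -
  obtain i j where k: "k = int i" and n: "n = int (i + j)"
    using assms by (metis add.commute diff_add_cancel int_nat_eq nonneg_int_cases of_nat_add zle_iff_zadd)
  have ab: "(4 - sqrt 15) ^ i * (4 + sqrt 15) ^ i = 1" for i
    by (simp add: sqrt15_prod flip: power_mult_distrib)
  have "(4 - sqrt 15) ^ (i + j) * (4 + sqrt 15) ^ i = (4 - sqrt 15) ^ j"
    "(4 - sqrt 15) ^ (i + j) * (4 + sqrt 15) ^ j = (4 - sqrt 15) ^ i"
    using ab[of i] ab[of j] by (simp_all add: power_add mult_ac)
  moreover have "nat (int (i + j) - int i) = j" "nat (int (i + j)) = i + j" "nat (int i) = i" by auto
  ultimately show ?thesis unfolding rung_profile_def k n by (simp only: minus_divide_left minus_diff_eq)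
qed

lemma rung_profile_step:
  assumes "0 < k"
  shows "8 * rung_profile n k - rung_profile n (k + 1) - rung_profile n (k - 1) = 0"
proof -
  obtain i where k: "k = int (Suc i)" using assms by (metis gr0_implies_Suc zero_less_imp_eq_int)
  have *: "nat (int (Suc i) + 1) = Suc (Suc i)" "nat (int (Suc i) - 1) = i" "nat (int (Suc i)) = Suc i" by auto
  have sq: "sqrt 15 * sqrt 15 = 15" "sqrt 15 * (sqrt 15 * x) = 15 * x" for x :: real
    by (simp_all flip: mult.assoc)
  show ?thesis
    unfolding rung_profile_def diff_divide_distrib[symmetric] times_divide_eq_right k *
    by (simp add: algebra_simps sq)
qed

text \<open>The jump condition at the source, both of whose neighbours carry the value at 1. It
  determines the denominator of \<open>rung_profile\<close>.\<close>

lemma rung_profile_start: "8 * rung_profile n 0 - 2 * rung_profile n 1 = 1"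
proof -
  have sq: "sqrt 15 * sqrt 15 = 15" "sqrt 15 * (sqrt 15 * x) = 15 * x" for x :: real
    by (simp_all flip: mult.assoc)
  have "2 * sqrt 15 * (1 + (4 - sqrt 15) ^ nat n) \<noteq> 0" using sqrt15_pow_pos[of "nat n"] by simp
  thus ?thesis
    unfolding rung_profile_def diff_divide_distrib[symmetric] times_divide_eq_right
    by (subst divide_eq_1_iff) (simp add: algebra_simps)
qed

text \<open>The closed end \<open>r = n\<close> is included so that the successor of any point can
  be evaluated in the same period.\<close>

lemma rung_green_eq:
  assumes n: "n > 0" and r: "0 \<le> r" "r \<le> n"
  shows "rung_green n (q * n + r) = par q * rung_profile n r"
proof (cases "r = n")
  case True
  have "q * n + n = (q + 1) * n" by (simp add: algebra_simps)
  hence "rung_green n (q * n + n) = par (q + 1) * rung_profile n 0"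
    using n by (simp add: rung_green_def del: mult_cancel_right)
  thus ?thesis using True rung_profile_reflect[of 0 n] n by (simp add: par_add_one)
next
  case False
  hence "(q * n + r) div n = q" "(q * n + r) mod n = r" using r n by (simp_all)
  thus ?thesis by (simp add: rung_green_def)
qed

lemma rung_green_shift: "n > 0 \<Longrightarrow> rung_green n (m + n) = - rung_green n m"
  by (simp add: rung_green_def par_add_one)

lemma rung_green_recurrence:
  assumes n: "n > 0"
  shows "8 * rung_green n m - rung_green n (m + 1) - rung_green n (m - 1) = anti_delta n m"
proof -
  define q r where "q = m div n" and "r = m mod n"
  have m: "m = q * n + r" and r: "0 \<le> r" "r < n" using n by (simp_all add: q_def r_def)
  have 0: "rung_green n m = par q * rung_profile n r"
    unfolding m by (rule rung_green_eq) (use r n in auto)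
  have 1: "rung_green n (m + 1) = par q * rung_profile n (r + 1)"
    using rung_green_eq[OF n, of "r + 1" q] r m by (simp add: add.assoc)
  show ?thesis
  proof (cases "r = 0")
    case True
    \<comment> \<open>The left neighbour of the source lies in the previous period; its sign change
      and that of the reflection cancel.\<close>
    have "m - 1 = (q - 1) * n + (n - 1)" using True m by (simp add: algebra_simps)
    hence "rung_green n (m - 1) = par (q - 1) * rung_profile n (n - 1)"
      using rung_green_eq[OF n, of "n - 1" "q - 1"] n by simp (simp add: algebra_simps)
    also have "\<dots> = par q * rung_profile n 1"
      using n rung_profile_reflect[of 1 n] by (simp add: par_add_one)
    finally have 2: "rung_green n (m - 1) = par q * rung_profile n 1" .
    have "anti_delta n m = par q" using True m n by (simp add: anti_delta_def)
    moreover have "8 * (par q * rung_profile n 0) - par q * rung_profile n 1 - par q * rung_profile n 1 = par q * (8 * rung_profile n 0 - 2 * rung_profile n 1)"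
      by (simp add: algebra_simps)
    ultimately show ?thesis using 0 1 2 True by (simp add: rung_profile_start)
  next
    case False
    have 2: "rung_green n (m - 1) = par q * rung_profile n (r - 1)"
      using rung_green_eq[OF n, of "r - 1" q] r m False by (simp add: add_diff_eq)
    have "anti_delta n m = 0" using False r by (simp add: anti_delta_def dvd_eq_mod_eq_0 r_def)
    moreover have "8 * (par q * rung_profile n r) - par q * rung_profile n (r + 1) - par q * rung_profile n (r - 1)
        = par q * (8 * rung_profile n r - rung_profile n (r + 1) - rung_profile n (r - 1))"
      by (simp add: algebra_simps)
    ultimately show ?thesis using 0 1 2 rung_profile_step[of r n] r False by simp
  qed
qed

section \<open>From the rungs to all positions\<close>

text \<open>In positions counted from 0 the rungs sit at the multiples of 3. Between them a solution
  without sources is linear, so its values at the rungs determine it.\<close>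

definition interp :: "(int \<Rightarrow> real) \<Rightarrow> int \<Rightarrow> real" where
  "interp f i = (of_int (3 - i mod 3) * f (i div 3) + of_int (i mod 3) * f (i div 3 + 1)) / 3"

lemma interp_simps:
  "interp f (3 * p) = f p"
  "interp f (3 * p + 1) = (2 * f p + f (p + 1)) / 3"
  "interp f (3 * p + 2) = (f p + 2 * f (p + 1)) / 3"
proof -
  have "(3 * p + 1) div 3 = p" "(3 * p + 1) mod 3 = 1" "(3 * p + 2) div 3 = p" "(3 * p + 2) mod 3 = 2"
    by presburger+
  thus "interp f (3 * p) = f p" "interp f (3 * p + 1) = (2 * f p + f (p + 1)) / 3"
    "interp f (3 * p + 2) = (f p + 2 * f (p + 1)) / 3"
    by (simp_all add: interp_def)
qed

text \<open>The correction \<open>seg_green\<close> for sources between two rungs is the Dirichlet Green function of a path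
  with three edges.\<close>

definition seg_green :: "int \<Rightarrow> int \<Rightarrow> int \<Rightarrow> real" where
  "seg_green n i j = anti_delta n (i div 3 - j div 3) *
     of_int (min (i mod 3) (j mod 3) * (3 - max (i mod 3) (j mod 3))) / 3"

text \<open>On interpolated functions the odd operator at a rung is one third of
  \<open>8 * H m - H (m + 1) - H (m - 1)\<close>; this explains the factor 3. By symmetry the source
  is interpolated too: one between two rungs acts on the rungs like its linear splitting onto
  them.\<close>

definition anti_green :: "int \<Rightarrow> int \<Rightarrow> int \<Rightarrow> real" where
  "anti_green n i j = 3 * interp (\<lambda>p. interp (\<lambda>q. rung_green n (p - q)) j) i + seg_green n i j"

lemma anti_green_shift:
  assumes "n > 0"
  shows "anti_green n (i + 3 * n) j = - anti_green n i j"
proof -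
  have d: "(i + 3 * n) div 3 = i div 3 + n" and m: "(i + 3 * n) mod 3 = i mod 3" by presburger+
  have *: "rung_green n (p + n - q) = - rung_green n (p - q)" "anti_delta n (p + n - q) = - anti_delta n (p - q)" 
     "rung_green n (p + n + 1 - q) = - rung_green n (p + 1 - q)" for p q
    using rung_green_shift[OF assms, of "p - q"] anti_delta_shift[OF assms, of "p - q"]
      rung_green_shift[OF assms, of "p + 1 - q"] by (simp_all add: algebra_simps)
  show ?thesis
    unfolding anti_green_def interp_def seg_green_def d m * diff_diff_eq[symmetric]
    using rung_green_shift[OF assms, of "i div 3 - j div 3 - 1"] rung_green_shift[OF assms, of "i div 3 + 1 - j div 3 - 1"]
    by (simp add: field_simps)
qed

text \<open>The split source leaves weighted unit masses at the two rungs next to \<open>j\<close>;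
  the end slopes of \<open>seg_green\<close> cancel them. Inside a segment the interpolated part is
  linear, and \<open>seg_green\<close> supplies the source.\<close>

lemma anti_green_laplace:
  assumes n: "n > 0"
  shows "(if 3 dvd i then 4 else 2) * anti_green n i j - anti_green n (i + 1) j - anti_green n (i - 1) j =
    (if i mod 3 = j mod 3 then anti_delta n (i div 3 - j div 3) else 0)"
proof -
  have dm: "(3 * p + 1) div 3 = p" "(3 * p + 1) mod 3 = 1" "(3 * p + 2) div 3 = p" "(3 * p + 2) mod 3 = 2"
    "3 * p + 1 + 1 = 3 * p + 2" "3 * p + 2 + 1 = 3 * (p + 1)" "3 * p + 1 - 1 = 3 * p" "3 * p + 2 - 1 = 3 * p + 1"
    "3 * p - 1 = 3 * (p - 1) + 2"
    "\<not> 3 dvd 3 * p + 1" "\<not> 3 dvd 3 * p + 2" for p :: int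
    by presburger+
  define p q where "p = i div 3" and "q = j div 3"
  have i: "i = 3 * p \<or> i = 3 * p + 1 \<or> i = 3 * p + 2" and j: "j = 3 * q \<or> j = 3 * q + 1 \<or> j = 3 * q + 2"
    unfolding p_def q_def by presburger+
  have rec: "8 * rung_green n (p - q) = rung_green n (p + 1 - q) + rung_green n (p - (q + 1)) + anti_delta n (p - q)"
    using rung_green_recurrence[OF n, of "p - q"] by (simp add: algebra_simps)
  have rec': "8 * rung_green n (p - (q + 1)) = rung_green n (p - q) + rung_green n (p - (q + 2)) + anti_delta n (p - (q + 1))"
    using rung_green_recurrence[OF n, of "p - (q + 1)"] by (simp add: algebra_simps)
  have e: "p + 1 - (q + 1) = p - q" "p - 1 - q = p - (q + 1)" "p - 1 - (q + 1) = p - (q + 2)" by simp_all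
  show ?thesis
    \<comment> \<open>Nine cases by the residues of \<open>i\<close> and \<open>j\<close>. The
      recurrences \<open>rec\<close> and \<open>rec'\<close> belong to the two rungs onto which the
      source is split.\<close>
    using i j
    by (elim disjE; hypsubst)
      (simp_all only: dm anti_green_def interp_simps seg_green_def e,
        insert rec rec', simp_all add: algebra_simps, simp_all add: field_simps)
qed

section \<open>The Laplacian of the network\<close>

lemma cyc_green_0: "cyc_green N 0 = 0"
  by (simp add: cyc_green_def)

lemma laplace_add: "laplace G (\<lambda>z. \<phi> z + \<psi> z) x = laplace G \<phi> x + laplace G \<psi> x"
  by (simp add: laplace_alt sum.distrib algebra_simps)

lemma Q_edge_iff:
  "{Plain a, Plain b} \<in> Q_edges n \<longleftrightarrow>
     1 \<le> a \<and> a \<le> 3 * n - 1 \<and> b = a + 1 \<or> 1 \<le> b \<and> b \<le> 3 * n - 1 \<and> a = b + 1"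
  "{Bar a, Bar b} \<in> Q_edges n \<longleftrightarrow>
     1 \<le> a \<and> a \<le> 3 * n - 1 \<and> b = a + 1 \<or> 1 \<le> b \<and> b \<le> 3 * n - 1 \<and> a = b + 1"
  "{Plain a, Bar b} \<in> Q_edges n \<longleftrightarrow>
     a = 3 * n \<and> b = 1 \<or> a = 1 \<and> b = 3 * n \<or> a = b \<and> 1 \<le> a \<and> a \<le> 3 * n \<and> a mod 3 = 1"
  "{Bar b, Plain a} \<in> Q_edges n \<longleftrightarrow>
     a = 3 * n \<and> b = 1 \<or> a = 1 \<and> b = 3 * n \<or> a = b \<and> 1 \<le> a \<and> a \<le> 3 * n \<and> a mod 3 = 1"
  unfolding Q_edges_def by (auto simp: doubleton_eq_iff)

lemma Q_no_loop: "{v} \<notin> snd (Q n)"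
  by (auto simp: Q_def Q_edges_def)

lemma fst_Q: "fst (Q n) = Q_verts n"
  by (simp add: Q_def)

lemma finite_Q_verts: "finite (fst (Q n))"
  by (simp add: fst_Q Q_verts_def)

lemma Q_verts_cases:
  assumes "v \<in> fst (Q n)"
  obtains i where "i < 3 * n" "v = Plain (Suc i)" | i where "i < 3 * n" "v = Bar (Suc i)"
proof -
  from assms obtain k where "k \<in> {1..3 * n}" "v = Plain k \<or> v = Bar k"
    by (auto simp: fst_Q Q_verts_def)
  thus ?thesis using that[of "k - 1"] by auto
qed

lemma Q_verts_mem: "Plain (Suc i) \<in> fst (Q n) \<longleftrightarrow> i < 3 * n" "Bar (Suc i) \<in> fst (Q n) \<longleftrightarrow> i < 3 * n"
  by (auto simp: fst_Q Q_verts_def)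

lemma sum_Q_verts:
  "(\<Sum>v\<in>fst (Q n). f v) = (\<Sum>i<3 * n. f (Plain (Suc i)) + f (Bar (Suc i)))"
proof -
  have "(\<Sum>v\<in>fst (Q n). f v) = (\<Sum>v\<in>Plain ` {1..3 * n}. f v) + (\<Sum>v\<in>Bar ` {1..3 * n}. f v)"
    unfolding fst_Q Q_verts_def by (rule sum.union_disjoint) auto
  also have "\<dots> = (\<Sum>k\<in>{1..3 * n}. f (Plain k) + f (Bar k))"
    by (simp add: sum.reindex inj_on_def sum.distrib)
  also have "\<dots> = (\<Sum>i<3 * n. f (Plain (Suc i)) + f (Bar (Suc i)))"
    by (simp add: sum.atLeast1_atMost_eq)
  finally show ?thesis .
qed

lemma nbrs_Q:
  assumes i: "i < 3 * n"
  shows "nbrs (Q n) (Plain (Suc i)) =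
      {if Suc i = 3 * n then Bar 1 else Plain (Suc (Suc i)), if i = 0 then Bar (3 * n) else Plain i} \<union>
      (if 3 dvd i then {Bar (Suc i)} else {})" (is "?l = ?r")
    and "nbrs (Q n) (Bar (Suc i)) =
      {if Suc i = 3 * n then Plain 1 else Bar (Suc (Suc i)), if i = 0 then Plain (3 * n) else Bar i} \<union>
      (if 3 dvd i then {Plain (Suc i)} else {})" (is "?l' = ?r'")
proof -
  have m: "Suc i mod 3 = 1 \<longleftrightarrow> 3 dvd i" by presburger
  have m': "Suc i mod 3 = Suc 0 \<longleftrightarrow> 3 dvd i" by presburger
  have h: "\<not> (3 dvd i \<and> Suc i = 3 * n)" by presburger
  note s = nbrs_def Q_def Q_verts_def Q_edge_iff m m'
  show "?l = ?r"
  proof (rule Set.set_eqI)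
    fix v show "v \<in> ?l \<longleftrightarrow> v \<in> ?r" using i h by (cases v) (auto simp: s)
  qed
  show "?l' = ?r'"
  proof (rule Set.set_eqI)
    fix v show "v \<in> ?l' \<longleftrightarrow> v \<in> ?r'" using i h by (cases v) (auto simp: s)
  qed
qed

definition qdeg :: "nat \<Rightarrow> real" where
  "qdeg i = (if 3 dvd i then 3 else 2)"

lemma qdeg_pos: "qdeg i > 0"
  by (simp add: qdeg_def)

lemma vdeg_Q:
  assumes "i < 3 * n"
  shows "real (vdeg (Q n) (Plain (Suc i))) = qdeg i" "real (vdeg (Q n) (Bar (Suc i))) = qdeg i"
  using assms by (auto simp: vdeg_def nbrs_Q qdeg_def card_insert_if)

text \<open>The integers unroll the outer cycle of length \<open>6 * n\<close>: after the plain
  vertices, \<open>Bar k\<close> has position \<open>3 * n + k - 1\<close>. There a function with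
  \<open>f (x + 3 * n) = \<sigma> * f x\<close> takes the value
  \<open>\<sigma> * f (k - 1)\<close>.\<close>

definition lift :: "real \<Rightarrow> (int \<Rightarrow> real) \<Rightarrow> vertex \<Rightarrow> real" where
  "lift \<sigma> f v = (case v of Plain k \<Rightarrow> f (int k - 1) | Bar k \<Rightarrow> \<sigma> * f (int k - 1))"

lemma lift_simps: "lift \<sigma> f (Plain (Suc i)) = f (int i)" "lift \<sigma> f (Bar (Suc i)) = \<sigma> * f (int i)"
  by (simp_all add: lift_def)

text \<open>A rung joins antipodal vertices and contributes \<open>f - \<sigma> * f\<close>, so the
  diagonal entry becomes \<open>3 - \<sigma>\<close>: 2 for even functions, as on a plain cycle, and
  4 for odd ones.\<close>

lemma laplace_lift:
  assumes i: "i < 3 * n" and \<sigma>: "\<sigma> * \<sigma> = 1" and f: "\<And>x. f (x + 3 * int n) = \<sigma> * f x"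
  shows "laplace (Q n) (lift \<sigma> f) (Plain (Suc i)) =
      (if 3 dvd i then 3 - \<sigma> else 2) * f (int i) - f (int i + 1) - f (int i - 1)" (is ?A)
    and "laplace (Q n) (lift \<sigma> f) (Bar (Suc i)) =
      \<sigma> * ((if 3 dvd i then 3 - \<sigma> else 2) * f (int i) - f (int i + 1) - f (int i - 1))" (is ?B)
proof -
  have ss: "\<sigma> * (\<sigma> * x) = x" for x using \<sigma> by (simp flip: mult.assoc)
  have f0: "f (3 * int n) = \<sigma> * f 0" using f[of 0] by simp
  have f1: "f (3 * int n - 1) = \<sigma> * f (- 1)" using f[of "-1"] by simp
  define nx pv where "nx = (if Suc i = 3 * n then Bar 1 else Plain (Suc (Suc i)))"
    and "pv = (if i = 0 then Bar (3 * n) else Plain i)"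
  define nx' pv' where "nx' = (if Suc i = 3 * n then Plain 1 else Bar (Suc (Suc i)))"
    and "pv' = (if i = 0 then Plain (3 * n) else Bar i)"
  have i1: "f (int i + 1) = \<sigma> * f 0" "f (1 + int i) = \<sigma> * f 0" if "Suc i = 3 * n"
  proof -
    have "int i + 1 = 3 * int n" using that by linarith
    thus "f (int i + 1) = \<sigma> * f 0" by (simp add: f0)
    thus "f (1 + int i) = \<sigma> * f 0" by (simp add: add.commute)
  qed
  have nx: "lift \<sigma> f nx = f (int i + 1)" "lift \<sigma> f nx' = \<sigma> * f (int i + 1)"
    using i1 by (auto simp: nx_def nx'_def lift_def f0 ss add.commute)
  have pv: "lift \<sigma> f pv = f (int i - 1)" "lift \<sigma> f pv' = \<sigma> * f (int i - 1)"
    by (auto simp: pv_def pv'_def lift_def f1 ss)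
  have d: "nx \<noteq> pv" "nx \<noteq> Bar (Suc i)" "pv \<noteq> Bar (Suc i)" "nx' \<noteq> pv'" "nx' \<noteq> Plain (Suc i)" "pv' \<noteq> Plain (Suc i)"
    using i by (auto simp: nx_def pv_def nx'_def pv'_def split: if_splits) 
  show ?A unfolding laplace_def nbrs_Q(1)[OF i] nx_def[symmetric] pv_def[symmetric]
    using d by (simp add: nx pv lift_simps algebra_simps)
  show ?B unfolding laplace_def nbrs_Q(2)[OF i] nx'_def[symmetric] pv'_def[symmetric]
    using d by (simp add: nx pv lift_simps algebra_simps ss \<sigma>)
qed

definition vpos :: "vertex \<Rightarrow> int" where
  "vpos v = (case v of Plain k \<Rightarrow> int k - 1 | Bar k \<Rightarrow> int k - 1)"

definition vsgn :: "vertex \<Rightarrow> real" where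
  "vsgn v = (case v of Plain k \<Rightarrow> 1 | Bar k \<Rightarrow> - 1)"

text \<open>\<open>vsgn\<close> is the sign by which the antipodal map acts on odd functions.\<close>

definition Q_green :: "nat \<Rightarrow> vertex \<Rightarrow> vertex \<Rightarrow> real" where
  "Q_green n u v = (cyc_green (3 * int n) (vpos u - vpos v) +
     vsgn u * vsgn v * anti_green (int n) (vpos u) (vpos v)) / 2"

lemma cyc_green_laplace_nat:
  assumes "i < 3 * n" "j < 3 * n"
  shows "2 * cyc_green (3 * int n) (int i - int j) - cyc_green (3 * int n) (int i + 1 - int j) -
      cyc_green (3 * int n) (int i - 1 - int j) = (if i = j then 1 else 0) - 1 / (3 * real n)"
proof -
  have "3 * int n dvd int i - int j \<longleftrightarrow> i = j"
  proof (cases "i = j")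
    case False
    have "\<bar>int i - int j\<bar> < \<bar>3 * int n\<bar>" using assms by linarith
    thus ?thesis using dvd_imp_le_int[of "int i - int j" "3 * int n"] False by auto
  qed simp
  moreover have "int i - int j + 1 = int i + 1 - int j" "int i - int j - 1 = int i - 1 - int j"
    by auto
  moreover have "3 * int n > 1" using assms by presburger
  moreover have "real_of_int (3 * int n) = 3 * real n" by simp
  ultimately show ?thesis
    using cyc_green_laplace[of "3 * int n" "int i - int j"] by (simp only:)
qed

lemma anti_green_laplace_nat:
  assumes "i < 3 * n" "j < 3 * n"
  shows "(if 3 dvd i then 4 else 2) * anti_green (int n) (int i) (int j) -
      anti_green (int n) (int i + 1) (int j) - anti_green (int n) (int i - 1) (int j) = (if i = j then 1 else 0)"
proof -
  have d: "3 dvd int i \<longleftrightarrow> 3 dvd i" by presburger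
  have "0 \<le> int i div 3" "int i div 3 < int n" "0 \<le> int j div 3" "int j div 3 < int n"
    using assms by presburger+
  hence "\<bar>int i div 3 - int j div 3\<bar> < int n" by linarith
  hence "anti_delta (int n) (int i div 3 - int j div 3) = (if int i div 3 = int j div 3 then 1 else 0)"
    by (simp add: anti_delta_small)
  moreover have "i = j \<longleftrightarrow> int i div 3 = int j div 3 \<and> int i mod 3 = int j mod 3"
    by (metis div_mult_mod_eq of_nat_eq_iff)
  ultimately show ?thesis
    using anti_green_laplace[of "int n" "int i" "int j"] assms unfolding d by auto
qed

text \<open>The unit mass at \<open>v\<close> is half of an even unit mass plus
  \<open>vsgn v\<close> times half of an odd one. Only the even part has a defect, and halving
  \<open>1 / (3 * n)\<close> gives the constant.\<close>

lemma laplace_Q_green: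
  assumes u: "u \<in> fst (Q n)" and v: "v \<in> fst (Q n)"
  shows "laplace (Q n) (\<lambda>z. Q_green n z v) u = (if u = v then 1 else 0) - 1 / (6 * real n)"
proof -
  define f g where "f = (\<lambda>x. cyc_green (3 * int n) (x - vpos v) / 2)"
    and "g = (\<lambda>x. vsgn v * anti_green (int n) x (vpos v) / 2)"
  have "Q_green n z v = lift 1 f z + lift (- 1) g z" for z
    by (cases z) (simp_all add: Q_green_def lift_def vpos_def vsgn_def f_def g_def field_simps)
  hence *: "laplace (Q n) (\<lambda>z. Q_green n z v) u = laplace (Q n) (lift 1 f) u + laplace (Q n) (lift (- 1) g) u"
    by (simp add: laplace_add)
  from u have n: "n > 0" by (cases "n = 0") (auto simp: fst_Q Q_verts_def)
  have f: "f (x + 3 * int n) = 1 * f x" for x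
    using cyc_green_periodic[of "3 * int n" "x - vpos v"] by (simp add: f_def algebra_simps)
  have g: "g (x + 3 * int n) = (- 1) * g x" for x
    using n by (simp add: g_def anti_green_shift)
  obtain j where j: "j < 3 * n" "vpos v = int j" and vj: "v = (if vsgn v = 1 then Plain (Suc j) else Bar (Suc j))"
    and sv: "vsgn v = 1 \<or> vsgn v = - 1"
    using v by (cases rule: Q_verts_cases) (auto simp: vpos_def vsgn_def)
  have F: "2 * f (int i) - f (int i + 1) - f (int i - 1) = ((if i = j then 1 else 0) - 1 / (3 * real n)) / 2" if "i < 3 * n" for i
    using cyc_green_laplace_nat[OF that j(1)] unfolding f_def j by (simp add: field_simps)
  have G: "(if 3 dvd i then 4 else 2) * g (int i) - g (int i + 1) - g (int i - 1) = vsgn v * (if i = j then 1 else 0) / 2" if "i < 3 * n" for i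
  proof -
    have "(if 3 dvd i then 4 else 2) * g (int i) - g (int i + 1) - g (int i - 1) =
      vsgn v * ((if 3 dvd i then 4 else 2) * anti_green (int n) (int i) (int j) -
      anti_green (int n) (int i + 1) (int j) - anti_green (int n) (int i - 1) (int j)) / 2"
      unfolding g_def j by (simp add: field_simps)
    thus ?thesis unfolding anti_green_laplace_nat[OF that j(1)] .
  qed
  show ?thesis
    using u
  proof (cases rule: Q_verts_cases)
    case (1 i)
    have "laplace (Q n) (\<lambda>z. Q_green n z v) u =
        (2 * f (int i) - f (int i + 1) - f (int i - 1)) + ((if 3 dvd i then 4 else 2) * g (int i) - g (int i + 1) - g (int i - 1))"
      unfolding 1(2) *[unfolded 1(2)] using laplace_lift(1)[OF 1(1), of 1 f, OF _ f] laplace_lift(1)[OF 1(1), of "- 1" g, OF _ g] by simp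
    thus ?thesis unfolding F[OF 1(1)] G[OF 1(1)] using sv by (subst (2) vj) (auto simp: 1(2) field_simps)
  next
    case (2 i)
    have "laplace (Q n) (\<lambda>z. Q_green n z v) u =
        (2 * f (int i) - f (int i + 1) - f (int i - 1)) - ((if 3 dvd i then 4 else 2) * g (int i) - g (int i + 1) - g (int i - 1))"
      unfolding 2(2) *[unfolded 2(2)] using laplace_lift(2)[OF 2(1), of 1 f, OF _ f] laplace_lift(2)[OF 2(1), of "- 1" g, OF _ g] by simp
    thus ?thesis unfolding F[OF 2(1)] G[OF 2(1)] using sv by (subst (2) vj) (auto simp: 2(2) field_simps)
  qed
qed

lemma sum_lessThan_mult_Suc_3:
  "(\<Sum>i<3 * Suc n. f i) = (\<Sum>i<3 * n. f i) + f (3 * n) + f (3 * n + 1) + f (3 * n + 2)"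
proof -
  have "3 * Suc n = Suc (Suc (Suc (3 * n)))" by simp
  thus ?thesis by (simp only: sum.lessThan_Suc) simp
qed

lemma qdeg_simps: "qdeg (3 * n) = 3" "qdeg (3 * n + 1) = 2" "qdeg (3 * n + 2) = 2"
proof -
  have "\<not> 3 dvd 3 * n + 1" "\<not> 3 dvd 3 * n + 2" by presburger+
  thus "qdeg (3 * n) = 3" "qdeg (3 * n + 1) = 2" "qdeg (3 * n + 2) = 2" by (simp_all add: qdeg_def)
qed

lemma sum_qdeg: "(\<Sum>i<3 * n. qdeg i) = 7 * real n"
  by (induction n) (simp_all only: sum_lessThan_mult_Suc_3 qdeg_simps, simp_all)

abbreviation "trace_anti n \<equiv> \<Sum>i<3 * n. qdeg i * anti_green (int n) (int i) (int i)"
abbreviation "sum_cyc n \<equiv> \<Sum>i<3 * n. \<Sum>j<3 * n. qdeg i * qdeg j * cyc_green (3 * int n) (int i - int j)"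

text \<open>Each Green function survives in exactly one term: \<open>cyc_green\<close> vanishes on
  the diagonal, and the signs cancel \<open>anti_green\<close> in the double sum.\<close>

lemma mult_degree_kirchhoff_Q:
  "mult_degree_kirchhoff (Q n) = 14 * real n * trace_anti n - 2 * sum_cyc n"
proof -
  have a: "(\<Sum>u\<in>fst (Q n). real (vdeg (Q n) u)) = 14 * real n"
    unfolding sum_Q_verts using sum_qdeg[of n] by (simp add: vdeg_Q flip: sum_distrib_left)
  have b: "(\<Sum>u\<in>fst (Q n). real (vdeg (Q n) u) * Q_green n u u) = trace_anti n"
    unfolding sum_Q_verts
    by (intro sum.cong refl) (simp add: vdeg_Q Q_green_def vpos_def vsgn_def cyc_green_0 field_simps)
  have c: "(\<Sum>u\<in>fst (Q n). \<Sum>v\<in>fst (Q n). real (vdeg (Q n) u) * real (vdeg (Q n) v) * Q_green n u v) = 2 * sum_cyc n"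
    unfolding sum_Q_verts sum.distrib[symmetric] sum_distrib_left
    by (intro sum.cong refl) (simp add: vdeg_Q Q_green_def vpos_def vsgn_def field_simps)
  show ?thesis
    using mult_degree_kirchhoff_green[OF finite_Q_verts laplace_Q_green, of n] unfolding a b c by simp
qed

section \<open>Inverting the two blocks\<close>

definition L_sgn :: "nat \<Rightarrow> real \<Rightarrow> real mat" where
  "L_sgn n \<sigma> = L_11 n + \<sigma> \<cdot>\<^sub>m L_12 n"

lemma L_sgn_carrier: "L_sgn n \<sigma> \<in> carrier_mat (3 * n) (3 * n)"
  by (simp add: L_sgn_def L_11_def L_12_def)

lemma L_A_eq: "L_A n = L_sgn n 1"
  by (rule eq_matI) (auto simp: L_A_def L_sgn_def L_11_def L_12_def)

lemma L_S_eq: "L_S n = L_sgn n (- 1)"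
  by (rule eq_matI) (auto simp: L_S_def L_sgn_def L_11_def L_12_def)

lemma L_sgn_index:
  assumes "i < 3 * n" "j < 3 * n"
  shows "L_sgn n \<sigma> $$ (i, j) = norm_laplacian (Q n) (Plain (Suc i)) (Plain (Suc j)) +
    \<sigma> * norm_laplacian (Q n) (Plain (Suc i)) (Bar (Suc j))"
  using assms by (simp add: L_sgn_def L_11_def L_12_def)

lemma snd_Q: "snd (Q n) = Q_edges n"
  by (simp add: Q_def)

lemma L_sgn_symmetric:
  assumes "i < 3 * n" "j < 3 * n"
  shows "L_sgn n \<sigma> $$ (i, j) = L_sgn n \<sigma> $$ (j, i)"
proof -
  have *: "norm_laplacian (Q n) (Plain (Suc a)) (Plain (Suc b)) = (if a = b then 1
      else if {Plain (Suc a), Plain (Suc b)} \<in> Q_edges n then - 1 / sqrt (qdeg a * qdeg b) else 0)"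
    "norm_laplacian (Q n) (Plain (Suc a)) (Bar (Suc b)) =
      (if {Plain (Suc a), Bar (Suc b)} \<in> Q_edges n then - 1 / sqrt (qdeg a * qdeg b) else 0)"
    if "a < 3 * n" "b < 3 * n" for a b
    using that by (simp_all add: norm_laplacian_def vdeg_Q snd_Q)
  have "{Plain (Suc i), Bar (Suc j)} \<in> Q_edges n \<longleftrightarrow> {Plain (Suc j), Bar (Suc i)} \<in> Q_edges n"
    by (auto simp: Q_edge_iff)
  thus ?thesis
    by (simp add: L_sgn_index * assms insert_commute mult.commute[of "qdeg j"])
qed

text \<open>On a function of symmetry type \<sigma> the two blocks in a row of the normalized
  Laplacian collapse into the single matrix \<open>L_sgn n \<sigma>\<close>.\<close>

lemma L_sgn_mult:
  assumes i: "i < 3 * n" and Y: "\<And>k. k < 3 * n \<Longrightarrow> Y (Bar (Suc k)) = \<sigma> * Y (Plain (Suc k))"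
  shows "(\<Sum>k<3 * n. L_sgn n \<sigma> $$ (i, k) * (sqrt (qdeg k) * Y (Plain (Suc k)))) =
    laplace (Q n) Y (Plain (Suc i)) / sqrt (qdeg i)"
proof -
  have "laplace (Q n) Y (Plain (Suc i)) / sqrt (qdeg i) =
      (\<Sum>k<3 * n. norm_laplacian (Q n) (Plain (Suc i)) (Plain (Suc k)) * (sqrt (qdeg k) * Y (Plain (Suc k))) +
        norm_laplacian (Q n) (Plain (Suc i)) (Bar (Suc k)) * (sqrt (qdeg k) * Y (Bar (Suc k))))"
    using norm_laplacian_mult[OF finite_Q_verts Q_verts_mem(1)[THEN iffD2, OF i] Q_no_loop, of Y]
    by (simp add: sum_Q_verts vdeg_Q i)
  also have "\<dots> = (\<Sum>k<3 * n. L_sgn n \<sigma> $$ (i, k) * (sqrt (qdeg k) * Y (Plain (Suc k))))"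
    by (intro sum.cong refl) (simp add: L_sgn_index i Y, simp add: algebra_simps)
  finally show ?thesis by simp
qed

lemma L_sgn_lift:
  assumes i: "i < 3 * n" and \<sigma>: "\<sigma> * \<sigma> = 1" and f: "\<And>x. f (x + 3 * int n) = \<sigma> * f x"
  shows "(\<Sum>k<3 * n. L_sgn n \<sigma> $$ (i, k) * (sqrt (qdeg k) * f (int k))) =
    ((if 3 dvd i then 3 - \<sigma> else 2) * f (int i) - f (int i + 1) - f (int i - 1)) / sqrt (qdeg i)"
  using L_sgn_mult[OF i, of "lift \<sigma> f" \<sigma>] laplace_lift(1)[of i n \<sigma> f, OF i \<sigma> f]
  by (simp add: lift_simps)

text \<open>An eigenvector, rescaled and extended with sign \<sigma>, is a function \<open>Y\<close>
  on the network. Where its absolute value is largest, \<open>Y\<close> times its Laplacian is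
  nonnegative, and it equals the eigenvalue times a positive number.\<close>

lemma proots_L_sgn_nonneg:
  assumes \<sigma>: "\<sigma> * \<sigma> = 1" and root: "poly (char_poly (L_sgn n \<sigma>)) x = 0"
  shows "x \<ge> 0"
proof -
  let ?L = "L_sgn n \<sigma>"
  note L = L_sgn_carrier[of n \<sigma>]
  from root eigenvalue_root_char_poly[OF L] obtain v where "eigenvector ?L v x"
    unfolding eigenvalue_def by blast
  hence v: "v \<in> carrier_vec (3 * n)" "v \<noteq> 0\<^sub>v (3 * n)" and Lv: "?L *\<^sub>v v = x \<cdot>\<^sub>v v"
    using L by (auto simp: eigenvector_def)
  define y where "y = (\<lambda>k. v $ k / sqrt (qdeg k))"
  define Y where "Y = (\<lambda>u. case u of Plain k \<Rightarrow> y (k - 1) | Bar k \<Rightarrow> \<sigma> * y (k - 1))"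
  have Y: "Y (Plain (Suc k)) = y k" "Y (Bar (Suc k)) = \<sigma> * y k" for k by (simp_all add: Y_def)
  have sq: "qdeg k \<noteq> 0" for k using qdeg_pos[of k] by simp
  have abs_\<sigma>: "\<bar>\<sigma>\<bar> = 1" using \<sigma> by (auto simp: square_eq_1_iff)
  from v obtain i0 where i0: "i0 < 3 * n" "v $ i0 \<noteq> 0" by force
  obtain i where i: "i < 3 * n" and max: "\<And>k. k < 3 * n \<Longrightarrow> \<bar>y k\<bar> \<le> \<bar>y i\<bar>"
  proof -
    let ?S = "(\<lambda>k. \<bar>y k\<bar>) ` {..<3 * n}"
    have fin: "finite ?S" "?S \<noteq> {}" using i0 by auto
    from Max_in[OF fin] obtain i where i: "i < 3 * n" "Max ?S = \<bar>y i\<bar>" by auto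
    show ?thesis
    proof (rule that[OF i(1)])
      fix k assume "k < 3 * n"
      thus "\<bar>y k\<bar> \<le> \<bar>y i\<bar>" using Max_ge[OF fin(1), of "\<bar>y k\<bar>"] i(2) by simp
    qed
  qed
  have "y i0 \<noteq> 0" using i0 sq by (simp add: y_def)
  hence yi: "y i \<noteq> 0" using max[OF i0(1)] by auto
  have "(\<Sum>k<3 * n. ?L $$ (i, k) * v $ k) = x * v $ i"
    using arg_cong[OF Lv, of "\<lambda>u. u $ i"] i L v by (simp add: scalar_prod_def lessThan_atLeast0)
  moreover have "(\<Sum>k<3 * n. ?L $$ (i, k) * (sqrt (qdeg k) * Y (Plain (Suc k)))) = (\<Sum>k<3 * n. ?L $$ (i, k) * v $ k)"
    by (intro sum.cong refl) (simp add: Y y_def sq)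
  ultimately have "laplace (Q n) Y (Plain (Suc i)) / sqrt (qdeg i) = x * v $ i"
    using L_sgn_mult[OF i, of Y \<sigma>] Y by simp
  also have "v $ i = sqrt (qdeg i) * y i" by (simp add: y_def sq)
  finally have lap: "laplace (Q n) Y (Plain (Suc i)) = x * (qdeg i * y i)"
    using sq[of i] qdeg_pos[of i] by (simp add: field_simps)
  have "0 \<le> Y (Plain (Suc i)) * laplace (Q n) Y (Plain (Suc i))"
  proof (rule laplace_at_extremum)
    fix z assume "z \<in> nbrs (Q n) (Plain (Suc i))"
    hence "z \<in> fst (Q n)" by (simp add: nbrs_def)
    thus "\<bar>Y z\<bar> \<le> \<bar>Y (Plain (Suc i))\<bar>"
      by (cases rule: Q_verts_cases) (auto simp: Y max abs_mult abs_\<sigma>)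
  qed
  hence "0 \<le> x * (qdeg i * (y i)\<^sup>2)" by (simp add: lap Y power2_eq_square mult_ac)
  moreover have "qdeg i * (y i)\<^sup>2 > 0" using yi qdeg_pos[of i] by simp
  ultimately show ?thesis by (simp add: zero_le_mult_iff)
qed

definition inv_S :: "nat \<Rightarrow> real mat" where
  "inv_S n = mat (3 * n) (3 * n) (\<lambda>(i, j). sqrt (qdeg i) * anti_green (int n) (int i) (int j) * sqrt (qdeg j))"

lemma inv_S_carrier: "inv_S n \<in> carrier_mat (3 * n) (3 * n)"
  by (simp add: inv_S_def)

lemma mat_mult_index:
  assumes "A \<in> carrier_mat n m" "B \<in> carrier_mat m l" "i < n" "j < l"
  shows "(A * B) $$ (i, j) = (\<Sum>k<m. A $$ (i, k) * B $$ (k, j))"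
  using assms by (simp add: scalar_prod_def lessThan_atLeast0)

lemma L_S_inverse: "L_sgn n (- 1) * inv_S n = 1\<^sub>m (3 * n)"
proof (rule eq_matI)
  fix i j assume "i < dim_row (1\<^sub>m (3 * n) :: real mat)" "j < dim_col (1\<^sub>m (3 * n) :: real mat)"
  hence i: "i < 3 * n" and j: "j < 3 * n" by auto
  have n: "int n > 0" using i by auto
  have "(L_sgn n (- 1) * inv_S n) $$ (i, j) =
      (\<Sum>k<3 * n. L_sgn n (- 1) $$ (i, k) * (sqrt (qdeg k) * anti_green (int n) (int k) (int j))) * sqrt (qdeg j)"
    unfolding mat_mult_index[OF L_sgn_carrier inv_S_carrier i j] sum_distrib_right
    by (intro sum.cong refl) (simp add: inv_S_def j)
  also have "(\<Sum>k<3 * n. L_sgn n (- 1) $$ (i, k) * (sqrt (qdeg k) * anti_green (int n) (int k) (int j))) =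
      ((if 3 dvd i then 4 else 2) * anti_green (int n) (int i) (int j) -
        anti_green (int n) (int i + 1) (int j) - anti_green (int n) (int i - 1) (int j)) / sqrt (qdeg i)"
    by (subst L_sgn_lift[OF i, of "- 1" "\<lambda>x. anti_green (int n) x (int j)"])
      (simp_all add: anti_green_shift[OF n])
  also have "\<dots> = (if i = j then 1 else 0) / sqrt (qdeg i)"
    unfolding anti_green_laplace_nat[OF i j] ..
  also have "\<dots> * sqrt (qdeg j) = 1\<^sub>m (3 * n) $$ (i, j)" using i j qdeg_pos[of j] by simp
  finally show "(L_sgn n (- 1) * inv_S n) $$ (i, j) = 1\<^sub>m (3 * n) $$ (i, j)" .
qed (use L_sgn_carrier[of n "- 1"] inv_S_carrier[of n] in auto)

lemma sqrt_qdeg: "sqrt (qdeg i) * z * sqrt (qdeg i) = qdeg i * z"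
proof -
  have "sqrt (qdeg i) * z * sqrt (qdeg i) = (sqrt (qdeg i) * sqrt (qdeg i)) * z" by (simp only: mult_ac)
  thus ?thesis using qdeg_pos[of i] by simp
qed

lemma trace_inv_S: "(\<Sum>i<3 * n. inv_S n $$ (i, i)) = trace_anti n"
  by (intro sum.cong refl) (simp add: inv_S_def sqrt_qdeg)

section \<open>Kernel projection and the inverse for \<open>L_A\<close>\<close>

text \<open>A unit kernel vector of \<open>L_A\<close>: constants have Laplacian 0, conjugation
  turns them into square roots of degrees, and \<open>7 * n\<close> is the sum of
  \<open>qdeg\<close>. The product with \<open>null_row\<close> is the orthogonal projection onto
  its span.\<close>

definition null_col :: "nat \<Rightarrow> real mat" where
  "null_col n = mat (3 * n) 1 (\<lambda>(i, _). sqrt (qdeg i) / sqrt (7 * real n))"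

definition null_row :: "nat \<Rightarrow> real mat" where
  "null_row n = mat 1 (3 * n) (\<lambda>(_, i). sqrt (qdeg i) / sqrt (7 * real n))"

lemma null_carrier: "null_col n \<in> carrier_mat (3 * n) 1" "null_row n \<in> carrier_mat 1 (3 * n)"
  by (simp_all add: null_col_def null_row_def)

lemma null_row_col: "n > 0 \<Longrightarrow> (null_row n * null_col n) $$ (0, 0) = 1"
  using sum_qdeg[of n] qdeg_pos
  by (subst mat_mult_index[of _ 1 "3 * n" _ 1])
    (simp_all add: null_carrier null_row_def null_col_def less_imp_le flip: sum_divide_distrib)

lemma null_col_row_index:
  assumes "i < 3 * n" "j < 3 * n"
  shows "(null_col n * null_row n) $$ (i, j) = sqrt (qdeg i) * sqrt (qdeg j) / (7 * real n)"
  unfolding mat_mult_index[OF null_carrier assms] using assms by (simp add: null_row_def null_col_def)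

lemma L_A_null: "L_sgn n 1 * null_col n = 0\<^sub>m (3 * n) 1"
proof (rule eq_matI)
  fix i j assume "i < dim_row (0\<^sub>m (3 * n) 1 :: real mat)" "j < dim_col (0\<^sub>m (3 * n) 1 :: real mat)"
  hence i: "i < 3 * n" and j: "j < 1" by auto
  have "(L_sgn n 1 * null_col n) $$ (i, j) = (\<Sum>k<3 * n. L_sgn n 1 $$ (i, k) * (sqrt (qdeg k) * (1 / sqrt (7 * real n))))"
    unfolding mat_mult_index[OF L_sgn_carrier null_carrier(1) i j]
    by (intro sum.cong refl) (use j in \<open>simp add: null_col_def\<close>)
  also have "\<dots> = 0" using L_sgn_lift[OF i, of 1 "\<lambda>x. 1 / sqrt (7 * real n)"] by simp
  finally show "(L_sgn n 1 * null_col n) $$ (i, j) = 0\<^sub>m (3 * n) 1 $$ (i, j)" using i j by simp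
qed (use L_sgn_carrier[of n 1] null_carrier[of n] in auto)

definition cyc_row :: "nat \<Rightarrow> int \<Rightarrow> real" where
  "cyc_row n x = (\<Sum>l<3 * n. qdeg l * cyc_green (3 * int n) (x - int l)) / (7 * real n)"

definition cyc_col :: "nat \<Rightarrow> int \<Rightarrow> real" where
  "cyc_col n y = (\<Sum>l<3 * n. qdeg l * cyc_green (3 * int n) (int l - y)) / (7 * real n)"

text \<open>Cycle Green function normalised to have degree-weighted mean 0 in each argument.\<close>

definition deg_green :: "nat \<Rightarrow> int \<Rightarrow> int \<Rightarrow> real" where
  "deg_green n x y = cyc_green (3 * int n) (x - y) - cyc_row n x - cyc_col n y + sum_cyc n / (7 * real n)\<^sup>2"

lemma sum_cyc_row: "(\<Sum>i<3 * n. qdeg i * cyc_row n (int i)) = sum_cyc n / (7 * real n)"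
  by (simp add: cyc_row_def sum_divide_distrib sum_distrib_left mult.assoc)

lemma sum_cyc_col: "(\<Sum>i<3 * n. qdeg i * cyc_col n (int i)) = sum_cyc n / (7 * real n)"
proof -
  have "(\<Sum>i<3 * n. qdeg i * cyc_col n (int i)) =
      (\<Sum>i<3 * n. \<Sum>l<3 * n. qdeg l * qdeg i * cyc_green (3 * int n) (int l - int i)) / (7 * real n)"
    by (simp add: cyc_col_def sum_divide_distrib sum_distrib_left mult_ac)
  also have "(\<Sum>i<3 * n. \<Sum>l<3 * n. qdeg l * qdeg i * cyc_green (3 * int n) (int l - int i)) = sum_cyc n"
    by (rule sum.swap)
  finally show ?thesis .
qed

lemma deg_green_period: "deg_green n (x + 3 * int n) y = deg_green n x y"
proof -
  have "cyc_green (3 * int n) (x + 3 * int n - z) = cyc_green (3 * int n) (x - z)" for z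
    using cyc_green_periodic[of "3 * int n" "x - z"] by (simp add: algebra_simps)
  thus ?thesis by (simp add: deg_green_def cyc_row_def)
qed

text \<open>After conjugation this says that the kernel projection annihilates
  \<open>deg_green\<close>.\<close>

lemma deg_green_mean:
  assumes "n > 0"
  shows "(\<Sum>i<3 * n. qdeg i * deg_green n (int i) y) = 0"
proof -
  let ?c = "cyc_green (3 * int n)"
  \<comment> \<open>Naming the constant keeps the simplifier from distributing over the double sum
    inside it.\<close>
  define X where "X = sum_cyc n / (7 * real n)\<^sup>2"
  have dg: "deg_green n x y = cyc_green (3 * int n) (x - y) - cyc_row n x - cyc_col n y + X" for x y
    by (simp add: deg_green_def X_def)
  have "(\<Sum>i<3 * n. qdeg i * deg_green n (int i) y) = (\<Sum>i<3 * n. qdeg i * ?c (int i - y)) -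
      (\<Sum>i<3 * n. qdeg i * cyc_row n (int i)) - (\<Sum>i<3 * n. qdeg i) * cyc_col n y +
      (\<Sum>i<3 * n. qdeg i) * X"
    by (simp add: dg algebra_simps sum.distrib sum_subtractf sum_distrib_left sum_distrib_right)
  also have "(\<Sum>i<3 * n. qdeg i) * cyc_col n y = (\<Sum>i<3 * n. qdeg i * ?c (int i - y))"
    using assms by (simp add: cyc_col_def sum_qdeg)
  finally show ?thesis unfolding sum_cyc_row sum_qdeg X_def using assms by (simp add: power2_eq_square)
qed

text \<open>The diagonal of \<open>cyc_green\<close> is 0. The two subtracted means contribute
  \<open>- sum_cyc n / (7 * n)\<close> each, and the added constant restores one of them.\<close>

lemma deg_green_trace:
  assumes "n > 0"
  shows "(\<Sum>i<3 * n. qdeg i * deg_green n (int i) (int i)) = - sum_cyc n / (7 * real n)"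
proof -
  define X where "X = sum_cyc n / (7 * real n)\<^sup>2"
  have dg: "deg_green n x y = cyc_green (3 * int n) (x - y) - cyc_row n x - cyc_col n y + X" for x y
    by (simp add: deg_green_def X_def)
  have "(\<Sum>i<3 * n. qdeg i * deg_green n (int i) (int i)) =
      - (\<Sum>i<3 * n. qdeg i * cyc_row n (int i)) - (\<Sum>i<3 * n. qdeg i * cyc_col n (int i)) +
      (\<Sum>i<3 * n. qdeg i) * X"
    by (simp add: dg algebra_simps sum.distrib sum_subtractf sum_distrib_left sum_distrib_right
        cyc_green_0 sum_negf)
  thus ?thesis unfolding sum_cyc_row sum_cyc_col sum_qdeg X_def using assms by (simp add: power2_eq_square)
qed

text \<open>Subtracting \<open>cyc_row\<close> trades the uniform defect \<open>1 / (3 * n)\<close>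
  for one proportional to the degree, which conjugation turns into the kernel projection.\<close>

lemma deg_green_laplace:
  assumes i: "i < 3 * n" and j: "j < 3 * n"
  shows "2 * deg_green n (int i) (int j) - deg_green n (int i + 1) (int j) - deg_green n (int i - 1) (int j) =
    (if i = j then 1 else 0) - qdeg i / (7 * real n)"
proof -
  let ?c = "cyc_green (3 * int n)"
  have n: "n > 0" using i by auto
  have "2 * cyc_row n (int i) - cyc_row n (int i + 1) - cyc_row n (int i - 1) =
      (\<Sum>l<3 * n. qdeg l * (2 * ?c (int i - int l) - ?c (int i + 1 - int l) - ?c (int i - 1 - int l))) / (7 * real n)"
  proof -
    have "(\<Sum>l<3 * n. qdeg l * (2 * ?c (int i - int l) - ?c (int i + 1 - int l) - ?c (int i - 1 - int l))) =
        2 * (\<Sum>l<3 * n. qdeg l * ?c (int i - int l)) - (\<Sum>l<3 * n. qdeg l * ?c (int i + 1 - int l)) -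
        (\<Sum>l<3 * n. qdeg l * ?c (int i - 1 - int l))"
      by (simp add: right_diff_distrib sum_subtractf sum_distrib_left mult.left_commute)
    thus ?thesis by (simp add: cyc_row_def diff_divide_distrib)
  qed
  also have "(\<Sum>l<3 * n. qdeg l * (2 * ?c (int i - int l) - ?c (int i + 1 - int l) - ?c (int i - 1 - int l))) =
      (\<Sum>l<3 * n. (if l = i then qdeg l else 0) - qdeg l / (3 * real n))"
    by (intro sum.cong refl) (simp add: cyc_green_laplace_nat i, simp add: algebra_simps)
  also have "\<dots> = qdeg i - 7 / 3"
    using i n by (simp add: sum_subtractf sum_qdeg flip: sum_divide_distrib)
  finally have r: "2 * cyc_row n (int i) - cyc_row n (int i + 1) - cyc_row n (int i - 1) = (qdeg i - 7 / 3) / (7 * real n)" .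
  have "2 * deg_green n (int i) (int j) - deg_green n (int i + 1) (int j) - deg_green n (int i - 1) (int j) =
      (2 * ?c (int i - int j) - ?c (int i + 1 - int j) - ?c (int i - 1 - int j)) -
      (2 * cyc_row n (int i) - cyc_row n (int i + 1) - cyc_row n (int i - 1))"
    by (simp add: deg_green_def)
  thus ?thesis unfolding cyc_green_laplace_nat[OF i j] r using n by (simp add: field_simps)
qed

text \<open>The conjugated \<open>deg_green\<close> is the pseudoinverse of \<open>L_A\<close>; the
  summand \<open>1 / (7 * n)\<close> becomes the kernel projection, which is its own inverse on the
  kernel.\<close>

definition inv_A :: "nat \<Rightarrow> real mat" where
  "inv_A n = mat (3 * n) (3 * n)
     (\<lambda>(i, j). sqrt (qdeg i) * (deg_green n (int i) (int j) + 1 / (7 * real n)) * sqrt (qdeg j))"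

lemma inv_A_carrier: "inv_A n \<in> carrier_mat (3 * n) (3 * n)"
  by (simp add: inv_A_def)

lemma L_A_inverse: "(L_sgn n 1 + null_col n * null_row n) * inv_A n = 1\<^sub>m (3 * n)"
proof (rule eq_matI)
  fix i j assume "i < dim_row (1\<^sub>m (3 * n) :: real mat)" "j < dim_col (1\<^sub>m (3 * n) :: real mat)"
  hence i: "i < 3 * n" and j: "j < 3 * n" by auto
  have n: "n > 0" using i by auto
  let ?N = "null_col n * null_row n"
  let ?f = "\<lambda>x. deg_green n x (int j) + 1 / (7 * real n)"
  have NN: "?N \<in> carrier_mat (3 * n) (3 * n)" using null_carrier by (intro mult_carrier_mat)
  \<comment> \<open>\<open>L_A\<close> contributes the identity minus the projection; the projection
    itself contributes the missing part in \<open>2\<close>.\<close>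
  have 1: "(\<Sum>k<3 * n. L_sgn n 1 $$ (i, k) * inv_A n $$ (k, j)) =
      ((if i = j then 1 else 0) - qdeg i / (7 * real n)) / sqrt (qdeg i) * sqrt (qdeg j)"
  proof -
    have "(\<Sum>k<3 * n. L_sgn n 1 $$ (i, k) * inv_A n $$ (k, j)) =
        (\<Sum>k<3 * n. L_sgn n 1 $$ (i, k) * (sqrt (qdeg k) * ?f (int k))) * sqrt (qdeg j)"
      unfolding sum_distrib_right by (intro sum.cong refl) (simp add: inv_A_def j)
    also have "(\<Sum>k<3 * n. L_sgn n 1 $$ (i, k) * (sqrt (qdeg k) * ?f (int k))) =
        (2 * ?f (int i) - ?f (int i + 1) - ?f (int i - 1)) / sqrt (qdeg i)"
      using L_sgn_lift[OF i, of 1 ?f] by (simp add: deg_green_period)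
    also have "2 * ?f (int i) - ?f (int i + 1) - ?f (int i - 1) = (if i = j then 1 else 0) - qdeg i / (7 * real n)"
    proof -
      have "2 * (a + e) - (b + e) - (c + e) = 2 * a - b - c" for a b c e :: real by simp
      thus ?thesis by (simp only: deg_green_laplace[OF i j])
    qed
    finally show ?thesis .
  qed
  have 2: "(\<Sum>k<3 * n. ?N $$ (i, k) * inv_A n $$ (k, j)) = sqrt (qdeg i) * sqrt (qdeg j) / (7 * real n)"
  proof -
    have "(\<Sum>k<3 * n. ?N $$ (i, k) * inv_A n $$ (k, j)) =
        (\<Sum>k<3 * n. sqrt (qdeg i) * sqrt (qdeg j) / (7 * real n) * (qdeg k * deg_green n (int k) (int j) + qdeg k / (7 * real n)))"
    proof (intro sum.cong refl)
      fix k assume k: "k \<in> {..<3 * n}"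
      have sq: "sqrt (qdeg k) * sqrt (qdeg k) = qdeg k" using qdeg_pos[of k] by simp
      have "a * c / v * (c * (z + w) * b) = a * b / v * (c * c * z + c * c * w)" for a b c v z w :: real
        by (simp add: algebra_simps add_divide_distrib)
      from this[of "sqrt (qdeg i)" "sqrt (qdeg k)" "7 * real n" _ "1 / (7 * real n)" "sqrt (qdeg j)", unfolded sq]
      show "?N $$ (i, k) * inv_A n $$ (k, j) =
        sqrt (qdeg i) * sqrt (qdeg j) / (7 * real n) * (qdeg k * deg_green n (int k) (int j) + qdeg k / (7 * real n))"
        using k i j by (simp add: null_col_row_index inv_A_def)
    qed
    also have "\<dots> = sqrt (qdeg i) * sqrt (qdeg j) / (7 * real n) *
        ((\<Sum>k<3 * n. qdeg k * deg_green n (int k) (int j)) + (\<Sum>k<3 * n. qdeg k) / (7 * real n))"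
      unfolding sum_distrib_left[symmetric] sum.distrib sum_divide_distrib ..
    finally show ?thesis unfolding deg_green_mean[OF n] sum_qdeg using n by simp
  qed
  have "((L_sgn n 1 + ?N) * inv_A n) $$ (i, j) =
      (\<Sum>k<3 * n. L_sgn n 1 $$ (i, k) * inv_A n $$ (k, j)) + (\<Sum>k<3 * n. ?N $$ (i, k) * inv_A n $$ (k, j))"
    unfolding mat_mult_index[OF add_carrier_mat[OF NN] inv_A_carrier i j] sum.distrib[symmetric]
    by (intro sum.cong refl) (use i in \<open>simp add: distrib_right carrier_matD[OF null_carrier(1)] carrier_matD[OF null_carrier(2)]\<close>)
  also have "\<dots> = 1\<^sub>m (3 * n) $$ (i, j)"
  proof -
    have "qdeg i / (7 * real n) / sqrt (qdeg i) = sqrt (qdeg i) / (7 * real n)"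
    proof -
      have "qdeg i / (7 * real n) / sqrt (qdeg i) = qdeg i / sqrt (qdeg i) / (7 * real n)"
        by (simp only: divide_divide_eq_left mult.commute)
      thus ?thesis using qdeg_pos[of i] by (simp add: real_div_sqrt)
    qed
    thus ?thesis unfolding 1 2 diff_divide_distrib left_diff_distrib
      using i j qdeg_pos[of j] by (cases "i = j") simp_all
  qed
  finally show "((L_sgn n 1 + ?N) * inv_A n) $$ (i, j) = 1\<^sub>m (3 * n) $$ (i, j)" .
qed (use null_carrier[of n] inv_A_carrier[of n] in auto)

lemma trace_inv_A:
  assumes "n > 0"
  shows "(\<Sum>i<3 * n. inv_A n $$ (i, i)) = 1 - sum_cyc n / (7 * real n)"
proof -
  have "(\<Sum>i<3 * n. inv_A n $$ (i, i)) =
      (\<Sum>i<3 * n. qdeg i * deg_green n (int i) (int i) + qdeg i / (7 * real n))"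
  proof (intro sum.cong refl)
    fix i assume i: "i \<in> {..<3 * n}"
    show "inv_A n $$ (i, i) = qdeg i * deg_green n (int i) (int i) + qdeg i / (7 * real n)"
      using i by (simp add: inv_A_def sqrt_qdeg) (simp add: distrib_left)
  qed
  also have "\<dots> = (\<Sum>i<3 * n. qdeg i * deg_green n (int i) (int i)) + (\<Sum>i<3 * n. qdeg i) / (7 * real n)"
    by (simp add: sum.distrib sum_divide_distrib)
  finally show ?thesis unfolding deg_green_trace[OF assms] sum_qdeg using assms by simp
qed

section \<open>Closed forms\<close>

lemma cyc_green_nat:
  assumes "i < 3 * n" "j < 3 * n"
  shows "cyc_green (3 * int n) (int i - int j) =
    ((real i - real j)\<^sup>2 - 3 * real n * \<bar>real i - real j\<bar>) / (6 * real n)"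
proof (cases "i \<ge> j")
  case True
  have "(int i - int j) mod (3 * int n) = int i - int j" using assms True by (intro mod_pos_pos_trivial) auto
  hence "cyc_green (3 * int n) (int i - int j) = - of_int ((int i - int j) * (3 * int n - (int i - int j))) / of_int (2 * (3 * int n))"
    unfolding cyc_green_def by (simp only:)
  thus ?thesis using True by (simp add: power2_eq_square algebra_simps minus_divide_left)
next
  case False
  have "(int i - int j) mod (3 * int n) = (int i - int j + 3 * int n) mod (3 * int n)" by simp
  also have "\<dots> = int i - int j + 3 * int n" using assms False by (intro mod_pos_pos_trivial) auto
  finally have "cyc_green (3 * int n) (int i - int j) = - of_int ((int i - int j + 3 * int n) * (3 * int n - (int i - int j + 3 * int n))) / of_int (2 * (3 * int n))"
    unfolding cyc_green_def by (simp only:)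
  thus ?thesis using False by (simp add: power2_eq_square algebra_simps minus_divide_left)
qed

lemma sum_qdeg_linear: "(\<Sum>i<3 * n. qdeg i * real i) = 21 / 2 * real n ^ 2 - 9 / 2 * real n"
  by (induction n)
    (simp_all only: sum_lessThan_mult_Suc_3 qdeg_simps, simp_all add: power2_eq_square field_simps)

lemma sum_qdeg_square:
  "(\<Sum>i<3 * n. qdeg i * (real i)\<^sup>2) = 21 * real n ^ 3 - 27 / 2 * real n ^ 2 + 5 / 2 * real n"
  by (induction n)
    (simp_all only: sum_lessThan_mult_Suc_3 qdeg_simps, simp_all add: power2_eq_square power3_eq_cube field_simps)

lemma sum_qdeg_diff_square:
  "(\<Sum>i<3 * n. \<Sum>j<3 * n. qdeg i * qdeg j * (real i - real j)\<^sup>2) = 147 / 2 * real n ^ 4 - 11 / 2 * real n ^ 2"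
proof -
  let ?d = qdeg
  have "(\<Sum>i<3 * n. \<Sum>j<3 * n. ?d i * ?d j * (real i - real j)\<^sup>2) =
      (\<Sum>i<3 * n. \<Sum>j<3 * n. (?d i * (real i)\<^sup>2) * ?d j) + (\<Sum>i<3 * n. \<Sum>j<3 * n. ?d i * (?d j * (real j)\<^sup>2))
      - 2 * (\<Sum>i<3 * n. \<Sum>j<3 * n. (?d i * real i) * (?d j * real j))"
    by (simp add: power2_diff algebra_simps sum.distrib sum_subtractf sum_distrib_left)
  thus ?thesis
    unfolding sum_product[symmetric] sum_qdeg sum_qdeg_linear sum_qdeg_square
    by (simp add: power2_eq_square power3_eq_cube power4_eq_xxxx algebra_simps)
qed

lemma sum_qdeg_abs_step:
  fixes s :: nat
  shows "(\<Sum>i<3 * n. qdeg i * \<bar>real i - real (3 * n + s)\<bar>) =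
    (3 * real n + real s) * (7 * real n) - (21 / 2 * real n ^ 2 - 9 / 2 * real n)"
proof -
  have "(\<Sum>i<3 * n. qdeg i * \<bar>real i - real (3 * n + s)\<bar>) =
      (\<Sum>i<3 * n. (3 * real n + real s) * qdeg i - qdeg i * real i)"
  proof (intro sum.cong refl)
    fix i assume "i \<in> {..<3 * n}"
    hence "real i < 3 * real n" by (simp flip: of_nat_less_iff)
    thus "qdeg i * \<bar>real i - real (3 * n + s)\<bar> = (3 * real n + real s) * qdeg i - qdeg i * real i"
      by (simp add: algebra_simps)
  qed
  also have "\<dots> = (3 * real n + real s) * (\<Sum>i<3 * n. qdeg i) - (\<Sum>i<3 * n. qdeg i * real i)"
    by (simp only: sum_subtractf sum_distrib_left)
  finally show ?thesis unfolding sum_qdeg sum_qdeg_linear .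
qed

lemma sum_qdeg_abs:
  "(\<Sum>i<3 * n. \<Sum>j<3 * n. qdeg i * qdeg j * \<bar>real i - real j\<bar>) = 49 * real n ^ 3 - 5 * real n"
proof (induction n)
  case (Suc n)
  let ?D = "\<Sum>i<3 * n. \<Sum>j<3 * n. qdeg i * qdeg j * \<bar>real i - real j\<bar>"
  let ?E = "\<lambda>s. \<Sum>i<3 * n. qdeg i * \<bar>real i - real (3 * n + s)\<bar>"
  have row: "(\<Sum>i<3 * n. qdeg i * c * \<bar>real i - x\<bar>) = c * (\<Sum>i<3 * n. qdeg i * \<bar>real i - x\<bar>)" for c x
    by (simp add: sum_distrib_left mult_ac)
  have col: "(\<Sum>i<3 * n. c * qdeg i * \<bar>x - real i\<bar>) = c * (\<Sum>i<3 * n. qdeg i * \<bar>real i - x\<bar>)" for c x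
    by (simp add: sum_distrib_left mult_ac abs_minus_commute)
  \<comment> \<open>The weights 3, 2, 2 are the degrees of the three new positions, the factor 2
    counts rows and columns, and 44 is the double sum over the new positions alone.\<close>
  have "(\<Sum>i<3 * Suc n. \<Sum>j<3 * Suc n. qdeg i * qdeg j * \<bar>real i - real j\<bar>) =
      ?D + 2 * (3 * ?E 0 + 2 * ?E 1 + 2 * ?E 2) + 44"
    unfolding sum_lessThan_mult_Suc_3 sum.distrib qdeg_simps row col
    by (simp add: add.commute)
  thus ?case unfolding Suc.IH sum_qdeg_abs_step
    by (simp add: power2_eq_square power3_eq_cube algebra_simps)
qed simp

lemma sum_cyc_eq:
  assumes "n > 0"
  shows "sum_cyc n = - 7 * real n * (147 * real n ^ 2 - 19) / 84"
proof -
  have "sum_cyc n = (\<Sum>i<3 * n. \<Sum>j<3 * n. qdeg i * qdeg j * (real i - real j)\<^sup>2 / (6 * real n) -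
      qdeg i * qdeg j * \<bar>real i - real j\<bar> / 2)"
    using assms by (intro sum.cong refl) (simp add: cyc_green_nat diff_divide_distrib right_diff_distrib)
  also have "\<dots> = (\<Sum>i<3 * n. \<Sum>j<3 * n. qdeg i * qdeg j * (real i - real j)\<^sup>2) / (6 * real n) -
      (\<Sum>i<3 * n. \<Sum>j<3 * n. qdeg i * qdeg j * \<bar>real i - real j\<bar>) / 2"
    by (simp only: sum_subtractf sum_divide_distrib)
  also have "\<dots> = - 7 * real n * (147 * real n ^ 2 - 19) / 84"
    unfolding sum_qdeg_diff_square sum_qdeg_abs using assms
    by (simp add: field_simps power2_eq_square power3_eq_cube power4_eq_xxxx)
  finally show ?thesis .
qed

text \<open>Inside a segment the value involves \<open>rung_profile\<close> at 0 and 1; the jump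
  condition at the source eliminates the latter, and its constant cancels the \<open>2 / 3\<close>
  from \<open>seg_green\<close>.\<close>

lemma anti_green_diagonal:
  assumes n: "n > 0"
  shows "anti_green n (3 * m) (3 * m) = 3 * rung_profile n 0"
    and "anti_green n (3 * m + 1) (3 * m + 1) = 7 * rung_profile n 0"
    and "anti_green n (3 * m + 2) (3 * m + 2) = 7 * rung_profile n 0"
proof -
  have dm: "(3 * m + 1) div 3 = m" "(3 * m + 1) mod 3 = 1" "(3 * m + 2) div 3 = m" "(3 * m + 2) mod 3 = 2"
    by presburger+
  have 0: "rung_green n 0 = rung_profile n 0" and 1: "rung_green n 1 = rung_profile n 1"
    using rung_green_eq[OF n, of 0 0] rung_green_eq[OF n, of 1 0] n by (simp_all add: par_def)
  have d: "anti_delta n 0 = 1" by (simp add: anti_delta_def par_def)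
  have h1: "rung_profile n 1 = 4 * rung_profile n 0 - 1 / 2" using rung_profile_start[of n] by linarith
  have m1: "rung_green n (- 1) = rung_profile n 1"
    using rung_green_recurrence[OF n, of 0] rung_profile_start[of n] by (simp add: 0 1 d)
  have e: "m - (m + 1) = - 1" "m + 1 - m = 1" "m + 1 - (m + 1) = 0" "m - m = 0" by simp_all
  show "anti_green n (3 * m) (3 * m) = 3 * rung_profile n 0"
    unfolding anti_green_def interp_simps by (simp add: seg_green_def 0)
  show "anti_green n (3 * m + 1) (3 * m + 1) = 7 * rung_profile n 0"
    unfolding anti_green_def interp_simps e seg_green_def dm 0 1 m1 d h1 by (simp add: field_simps)
  show "anti_green n (3 * m + 2) (3 * m + 2) = 7 * rung_profile n 0"
    unfolding anti_green_def interp_simps e seg_green_def dm 0 1 m1 d h1 by (simp add: field_simps)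
qed

lemma trace_anti_eq: "trace_anti n = xi n"
proof (cases "n = 0")
  case True
  thus ?thesis by (simp add: xi_def)
next
  case False
  define N where "N = int n"
  have N: "N > 0" using False by (simp add: N_def)
  \<comment> \<open>Each octagon contributes \<open>3 * 3 + 2 * 7 + 2 * 7 = 37\<close> times
    \<open>rung_profile N 0\<close>.\<close>
  have "(\<Sum>i<3 * m. qdeg i * anti_green N (int i) (int i)) = 37 * real m * rung_profile N 0" for m
  proof (induction m)
    case (Suc m)
    have c: "int (3 * m) = 3 * int m" "int (3 * m + 1) = 3 * int m + 1" "int (3 * m + 2) = 3 * int m + 2" by simp_all
    show ?case unfolding sum_lessThan_mult_Suc_3 qdeg_simps c anti_green_diagonal[OF N] Suc.IH
      by (simp add: algebra_simps)
  qed simp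
  hence "trace_anti n = 37 * real n * rung_profile (int n) 0" by (simp add: N_def)
  also have "\<dots> = xi n"
  proof -
    define A B where "A = (4 + sqrt 15) ^ n" and "B = (4 - sqrt 15) ^ n"
    have AB: "A * B = 1" unfolding A_def B_def using sqrt15_prod
      by (simp add: mult.commute flip: power_mult_distrib)
    have B: "B > 0" unfolding B_def by (rule sqrt15_pow_pos)
    have A: "A > 0" unfolding A_def by (intro zero_less_power add_pos_nonneg) auto
    have ABx: "A * (B * x) = x" for x using AB by (simp flip: mult.assoc)
    \<comment> \<open>With \<open>A * B = 1\<close>, numerator and denominator of \<open>xi\<close>
      share the factor \<open>A * (1 + B)\<close>, leaving the quotient found in
      \<open>rung_profile\<close>.\<close>
    have "A - B = A * ((1 - B) * (1 + B))" using AB by (simp add: algebra_simps ABx)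
    moreover have "A + B + 2 = A * ((1 + B) * (1 + B))" using AB by (simp add: algebra_simps ABx)
    ultimately have q: "(A - B) / (A + B + 2) = (1 - B) / (1 + B)" using A B by simp
    have "xi n = (37 * sqrt 15 * real n / 30 * ((A - B) / 12 ^ n)) / ((A + B + 2) / 12 ^ n)"
      unfolding xi_def power_divide power_one A_def[symmetric] B_def[symmetric]
      by (simp add: diff_divide_distrib add_divide_distrib)
    also have "\<dots> = 37 * sqrt 15 * real n / 30 * ((A - B) / (A + B + 2))" by simp
    also have "\<dots> = 37 * real n * ((1 - B) / (2 * sqrt 15 * (1 + B)))"
    proof -
      have s: "sqrt 15 / 30 = 1 / (2 * sqrt 15)" by (simp add: field_simps)
      have "37 * sqrt 15 * real n / 30 * z = 37 * real n * (sqrt 15 / 30 * z)" for z by simp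
      thus ?thesis unfolding q s by simp
    qed
    finally show ?thesis by (simp add: rung_profile_def B_def)
  qed
  finally show ?thesis .
qed

section \<open>Spectra of the two blocks and the final identity\<close>

lemma size_proots_L_sgn: "size (proots (char_poly (L_sgn n \<sigma>))) = 3 * n"
proof -
  obtain as where "char_poly (L_sgn n \<sigma>) = (\<Prod>a\<leftarrow>as. [:- a, 1:])" "length as = 3 * n"
    using char_poly_symmetric_real_splits[OF L_sgn_carrier L_sgn_symmetric] by blast
  thus ?thesis by (simp add: proots_prod_linear)
qed

lemma char_poly_nonzero: "A \<in> carrier_mat n n \<Longrightarrow> char_poly (A :: real mat) \<noteq> 0"
  using degree_monic_char_poly[of A n] by auto

lemma proots_L_S:
  shows "\<And>x. x \<in># proots (char_poly (L_S n)) \<Longrightarrow> x > 0"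
    and "(\<Sum>x\<in>#proots (char_poly (L_S n)). 1 / x) = xi n"
proof -
  note * = sum_inverse_proots_char_poly[OF L_sgn_carrier inv_S_carrier L_sgn_symmetric L_S_inverse]
  show "(\<Sum>x\<in>#proots (char_poly (L_S n)). 1 / x) = xi n"
    unfolding L_S_eq trace_anti_eq[symmetric] trace_inv_S[symmetric] by (rule *(2))
  fix x assume x: "x \<in># proots (char_poly (L_S n))"
  hence "x \<noteq> 0" using *(1) unfolding L_S_eq by metis
  moreover have "poly (char_poly (L_sgn n (- 1))) x = 0"
    using x char_poly_nonzero[OF L_sgn_carrier] unfolding L_S_eq by simp
  hence "x \<ge> 0" by (rule proots_L_sgn_nonneg[rotated]) simp
  ultimately show "x > 0" by simp
qed

lemma proots_L_A:
  assumes n: "n > 0"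
  obtains R where "proots (char_poly (L_A n)) = add_mset 0 R" "\<And>x. x \<in># R \<Longrightarrow> x > 0"
    "(\<Sum>x\<in>#R. 1 / x) = (147 * real n ^ 2 - 19) / 84"
proof -
  let ?L = "L_sgn n 1" and ?N = "null_col n * null_row n"
  let ?M = "?L + ?N"
  have NN: "?N \<in> carrier_mat (3 * n) (3 * n)" using null_carrier by (intro mult_carrier_mat)
  have M: "?M \<in> carrier_mat (3 * n) (3 * n)" using NN by simp
  have sym: "?M $$ (i, j) = ?M $$ (j, i)" if "i < 3 * n" "j < 3 * n" for i j
    using that NN L_sgn_symmetric[OF that, of 1]
    by (subst (1 2) index_add_mat(1)) (auto simp: null_col_row_index mult.commute simp del: index_mult_mat)
  note * = sum_inverse_proots_char_poly[OF M inv_A_carrier sym L_A_inverse]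
  have eq: "[:0, 1:] * char_poly ?M = [:-1, 1:] * char_poly ?L"
    by (rule char_poly_deflation[OF L_sgn_carrier null_carrier L_A_null null_row_col[OF n]])
  have "proots ([:0, 1:] * char_poly ?M) = add_mset 0 (proots (char_poly ?M))"
    using char_poly_nonzero[OF M] by (subst proots_mult) (simp_all only: proots_linear_factor, auto)
  moreover have "proots ([:-1, 1:] * char_poly ?L) = add_mset 1 (proots (char_poly ?L))"
    using char_poly_nonzero[OF L_sgn_carrier, of n 1]
    by (subst proots_mult) (simp_all only: proots_linear_factor, auto)
  \<comment> \<open>Read on multisets of roots, deflation shows that both spectra share a part
    \<open>R\<close>, completed by 1 for \<open>?M\<close> and by 0 for \<open>?L\<close>.\<close>
  ultimately have mset: "add_mset 0 (proots (char_poly ?M)) = add_mset 1 (proots (char_poly ?L))"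
    using eq by simp
  define R where "R = proots (char_poly ?M) - {#1#}"
  have "1 \<in># add_mset 0 (proots (char_poly ?M))" unfolding mset by simp
  hence MR: "proots (char_poly ?M) = add_mset 1 R" unfolding R_def by simp
  have LR: "proots (char_poly ?L) = add_mset 0 R" using mset unfolding MR
    by (simp add: add_mset_commute)
  show ?thesis
  proof (rule that)
    show "proots (char_poly (L_A n)) = add_mset 0 R" unfolding L_A_eq LR ..
    fix x assume x: "x \<in># R"
    hence "x \<noteq> 0" using *(1) unfolding MR by auto
    moreover have "x \<in># proots (char_poly ?L)" using x unfolding LR by simp
    hence "poly (char_poly ?L) x = 0" using char_poly_nonzero[OF L_sgn_carrier, of n 1] by simp
    hence "x \<ge> 0" by (rule proots_L_sgn_nonneg[rotated]) simp
    ultimately show "x > 0" by simp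
  next
    \<comment> \<open>The 1 on the left is the reciprocal of the deflated eigenvalue; the 1 on the
      right is the trace of the projection.\<close>
    have "1 + (\<Sum>x\<in>#R. 1 / x) = 1 - sum_cyc n / (7 * real n)"
      using *(2) unfolding MR trace_inv_A[OF n] by simp
    thus "(\<Sum>x\<in>#R. 1 / x) = (147 * real n ^ 2 - 19) / 84"
      unfolding sum_cyc_eq[OF n] using n by simp
  qed
qed

lemma sum_nth_pred:
  fixes xs :: "real list"
  shows "(\<Sum>j=1..length xs. 1 / xs ! (j - 1)) = (\<Sum>x\<in>#mset xs. 1 / x)"
proof -
  have "(\<Sum>x\<in>#mset xs. 1 / x) = (\<Sum>x\<leftarrow>xs. 1 / x)" by (metis mset_map sum_mset_sum_list)
  thus ?thesis by (simp add: sum.atLeast1_atMost_eq sum_list_sum_nth lessThan_atLeast0)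
qed

theorem theorem3p3:
  fixes n :: nat and \<alpha> \<rho> :: "nat \<Rightarrow> real"
  assumes "n \<ge> 1"
  defines "\<alpha> \<equiv> (\<lambda>j. eigenvalue_list (L_A n) ! (j - 1))"
    and "\<rho> \<equiv> (\<lambda>j. eigenvalue_list (L_S n) ! (j - 1))"
  shows "length (eigenvalue_list (L_A n)) = 3 * n \<and>
    length (eigenvalue_list (L_S n)) = 3 * n \<and>
    \<alpha> 1 = 0 \<and> 0 < \<alpha> 2 \<and> 0 < \<rho> 1 \<and>
    mult_degree_kirchhoff (Q n) =
      14 * real n * ((\<Sum>j=2..3*n. 1 / \<alpha> j) + (\<Sum>j=1..3*n. 1 / \<rho> j)) \<and>
    14 * real n * ((\<Sum>j=2..3*n. 1 / \<alpha> j) + (\<Sum>j=1..3*n. 1 / \<rho> j)) =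
      14 * real n * ((147 * real n ^ 2 - 19) / 84 + xi n) \<and>
    14 * real n * ((147 * real n ^ 2 - 19) / 84 + xi n) =
      147 * real n ^ 3 / 6 - 19 * real n / 6 + 14 * real n * xi n"
proof -
  from assms(1) have n: "n > 0" by simp
  obtain R where R: "proots (char_poly (L_A n)) = add_mset 0 R" "\<And>x. x \<in># R \<Longrightarrow> x > 0"
    "(\<Sum>x\<in>#R. 1 / x) = (147 * real n ^ 2 - 19) / 84"
    using proots_L_A[OF n] by blast
  define ys where "ys = sorted_list_of_multiset R"
  define zs where "zs = eigenvalue_list (L_S n)"
  have ys: "mset ys = R" by (simp add: ys_def)
  have zs: "mset zs = proots (char_poly (L_S n))" by (simp add: zs_def eigenvalue_list_def)
  \<comment> \<open>All of \<open>R\<close> is positive, so sorting puts the single 0 in front, and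
    the sum from index 2 is the sum over \<open>R\<close>.\<close>
  have list_A: "eigenvalue_list (L_A n) = 0 # ys"
    unfolding eigenvalue_list_def R(1) ys_def sorted_list_of_multiset_insert
    by (rule insort_is_Cons) (use R(2) in \<open>auto intro: less_imp_le\<close>)
  have len_A: "length (0 # ys) = 3 * n"
    using size_proots_L_sgn[of n 1] R(1) by (simp add: L_A_eq flip: ys)
  have len_S: "length zs = 3 * n"
    unfolding size_mset[symmetric] zs L_S_eq by (rule size_proots_L_sgn)
  have \<alpha>: "\<alpha> j = (0 # ys) ! (j - 1)" for j by (simp add: \<alpha>_def list_A)
  have \<rho>: "\<rho> j = zs ! (j - 1)" for j by (simp add: \<rho>_def zs_def)
  have \<alpha>2: "0 < \<alpha> 2"
  proof -
    have "ys ! 0 \<in># R" unfolding ys[symmetric] set_mset_mset using len_A n by (intro nth_mem) auto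
    thus ?thesis using R(2) by (simp add: \<alpha>)
  qed
  have \<rho>1: "0 < \<rho> 1"
  proof -
    have "zs ! 0 \<in># proots (char_poly (L_S n))"
      unfolding zs[symmetric] set_mset_mset using len_S n by (intro nth_mem) auto
    thus ?thesis using proots_L_S(1) by (simp add: \<rho>)
  qed
  have "(\<Sum>j=1..3 * n. 1 / \<alpha> j) = 1 / \<alpha> 1 + (\<Sum>j=2..3 * n. 1 / \<alpha> j)"
    using n by (subst sum.atLeast_Suc_atMost) (simp_all add: numeral_2_eq_2)
  hence sum_A: "(\<Sum>j=2..3 * n. 1 / \<alpha> j) = (147 * real n ^ 2 - 19) / 84"
    using sum_nth_pred[of "0 # ys"] R(3) unfolding len_A by (simp add: \<alpha> ys)
  have sum_S: "(\<Sum>j=1..3 * n. 1 / \<rho> j) = xi n"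
    using sum_nth_pred[of zs] unfolding len_S zs proots_L_S(2) by (simp add: \<rho>)
  have DK: "mult_degree_kirchhoff (Q n) = 14 * real n * ((147 * real n ^ 2 - 19) / 84 + xi n)"
    unfolding mult_degree_kirchhoff_Q trace_anti_eq sum_cyc_eq[OF n] by (simp add: field_simps)
  have "14 * real n * ((147 * real n ^ 2 - 19) / 84 + xi n) =
      147 * real n ^ 3 / 6 - 19 * real n / 6 + 14 * real n * xi n"
    by (simp add: field_simps power2_eq_square power3_eq_cube)
  moreover have "\<alpha> 1 = 0" by (simp add: \<alpha>)
  ultimately show ?thesis
    unfolding sum_A sum_S using len_A[folded list_A] len_S[unfolded zs_def] \<alpha>2 \<rho>1 DK by blast
qed

end
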